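(* Let $\Omega\subset\mathbb{R}^d$ be a nonempty compact set on which Lebesgue measure has full support, and let $K:\Omega\times\Omega\to\mathbb{R}$ be a continuous, symmetric, positive definite kernel with native space $\mathcal{H}(\Omega)$. Let $\lambda_1\ge\lambda_2\ge\dots>0$ be the eigenvalues of the integral operator $T$ of $K$ on $L_2(\Omega)$. For every integer $n>0$ set $$p_n := \inf_{\substack{V_n\subset\mathcal{H}(\Omega)\\ \dim V_n=n}} \Big\| \sup_{f\in\mathcal{H}(\Omega),\,\|f\|\le 1} \big|f(\cdot)-\Pi_{\mathcal{H},V_n}f(\cdot)\big| \Big\|_{L_2(\Omega)} .$$ Then $$p_n=\sqrt{\sum_{j>n}\lambda_j},$$ and the unique optimal subspace (i.e. the unique $n$-dimensional subspace of $\mathcal{H}(\Omega)$ attaining the infimum) is $E_n=\mathrm{span}\{\sqrt{\lambda_j}\varphi_j : j=1,\dots,n\}$. Here uniqueness is understood in the same sense as uniqueness of the eigendecomposition of $T$: a subspace $V_n$ attains the infimum if and only if $V_n=\mathrm{span}\{\varphi_1,\dots,\varphi_n\}$ for some choice of $L_2(\Omega)$-orthonormal eigenfunctions $\varphi_j$ with $T\varphi_j=\lambda_j\varphi_j$.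
   Context: A symmetric kernel $K$ is positive definite if for all finite sets of pairwise distinct points $x_1,\dots,x_m\in\Omega$ the matrix $[K(x_i,x_j)]_{i,j}$ is positive definite. The native space $\mathcal{H}(\Omega)$ is the unique Hilbert space of real functions on $\Omega$ with reproducing kernel $K$; its inner product and norm are written $(\cdot,\cdot)$ and $\|\cdot\|$. It embeds continuously in $L_2(\Omega)$ (Lebesgue measure). The operator $T:L_2(\Omega)\to L_2(\Omega)$ is $Tf(x)=\int_\Omega K(x,y)f(y)\,dy$; it is compact, self-adjoint and positive. $\lambda_1\ge\lambda_2\ge\dots>0$ are its positive eigenvalues counted with multiplicity, and $\{\varphi_j\}_{j\in\mathbb{N}}$ are corresponding $L_2(\Omega)$-orthonormal eigenfunctions, taken in $\mathcal{H}(\Omega)$ (as continuous representatives). For a finite-dimensional subspace $V_n\subset\mathcal{H}(\Omega)$, $\Pi_{\mathcal{H},V_n}$ is the $\mathcal{H}(\Omega)$-orthogonal projector onto $V_n$. The function inside the $L_2$ norm is the (generalized) Power Function of $V_n$. *)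

theory Defs
  imports "HOL-Analysis.Analysis" "HOL-Library.Function_Algebras"
begin

text \<open>
  Real functions form a real vector space under pointwise operations, so that the library's
  \<^const>\<open>subspace\<close>, \<^const>\<open>span\<close> and \<^const>\<open>dim\<close> apply to spaces of functions.
\<close>

instantiation "fun" :: (type, real_vector) real_vector
begin

definition scaleR_fun :: "real \<Rightarrow> ('a \<Rightarrow> 'b) \<Rightarrow> 'a \<Rightarrow> 'b" where
  "scaleR_fun c f = (\<lambda>x. c *\<^sub>R f x)"

instance
  by standard (simp_all add: scaleR_fun_def fun_eq_iff scaleR_add_right scaleR_add_left)

end

definition full_support :: "(real ^ 'd) set \<Rightarrow> bool" where
  "full_support \<Omega> \<longleftrightarrow>
     (\<forall>x\<in>\<Omega>. \<forall>U. open U \<and> x \<in> U \<longrightarrow> emeasure lebesgue (\<Omega> \<inter> U) > 0)"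

definition symmetric_kernel :: "'a set \<Rightarrow> ('a \<Rightarrow> 'a \<Rightarrow> real) \<Rightarrow> bool" where
  "symmetric_kernel \<Omega> K \<longleftrightarrow> (\<forall>x\<in>\<Omega>. \<forall>y\<in>\<Omega>. K x y = K y x)"

definition positive_definite_kernel :: "'a set \<Rightarrow> ('a \<Rightarrow> 'a \<Rightarrow> real) \<Rightarrow> bool" where
  "positive_definite_kernel \<Omega> K \<longleftrightarrow>
     (\<forall>X c. finite X \<and> X \<subseteq> \<Omega> \<and> (\<exists>x\<in>X. c x \<noteq> 0)
        \<longrightarrow> (\<Sum>x\<in>X. \<Sum>y\<in>X. c x * c y * K x y) > 0)"

text \<open>
  A real function on \<open>\<Omega>\<close> is represented by the total function that vanishes outside \<open>\<Omega>\<close>. A Hilbert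
  space of such functions is given by its carrier \<open>H\<close> and its inner product \<open>ip\<close>, of which only
  the values on \<open>H\<close> are relevant.
\<close>

definition ip_norm :: "('f \<Rightarrow> 'f \<Rightarrow> real) \<Rightarrow> 'f \<Rightarrow> real" where
  "ip_norm ip f = sqrt (ip f f)"

definition hilbert_function_space ::
  "'a set \<Rightarrow> ('a \<Rightarrow> real) set \<Rightarrow> (('a \<Rightarrow> real) \<Rightarrow> ('a \<Rightarrow> real) \<Rightarrow> real) \<Rightarrow> bool" where
  "hilbert_function_space \<Omega> H ip \<longleftrightarrow>
     subspace H \<and>
     (\<forall>f\<in>H. \<forall>x. x \<notin> \<Omega> \<longrightarrow> f x = 0) \<and>
     (\<forall>f\<in>H. \<forall>g\<in>H. ip f g = ip g f) \<and>
     (\<forall>f\<in>H. \<forall>g\<in>H. \<forall>h\<in>H. ip (f + g) h = ip f h + ip g h) \<and>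
     (\<forall>c. \<forall>f\<in>H. \<forall>g\<in>H. ip (c *\<^sub>R f) g = c * ip f g) \<and>
     (\<forall>f\<in>H. 0 \<le> ip f f \<and> (ip f f = 0 \<longrightarrow> f = 0)) \<and>
     (\<forall>F::nat \<Rightarrow> 'a \<Rightarrow> real.
        range F \<subseteq> H \<and> (\<forall>e>0. \<exists>N. \<forall>m\<ge>N. \<forall>n\<ge>N. ip_norm ip (F m - F n) < e)
        \<longrightarrow> (\<exists>f\<in>H. (\<lambda>n. ip_norm ip (F n - f)) \<longlonglongrightarrow> 0))"

definition kernel_section :: "'a set \<Rightarrow> ('a \<Rightarrow> 'a \<Rightarrow> real) \<Rightarrow> 'a \<Rightarrow> 'a \<Rightarrow> real" where
  "kernel_section \<Omega> K x = (\<lambda>y. if y \<in> \<Omega> then K x y else 0)"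

definition native_space ::
  "'a set \<Rightarrow> ('a \<Rightarrow> 'a \<Rightarrow> real) \<Rightarrow> ('a \<Rightarrow> real) set
     \<Rightarrow> (('a \<Rightarrow> real) \<Rightarrow> ('a \<Rightarrow> real) \<Rightarrow> real) \<Rightarrow> bool" where
  "native_space \<Omega> K H ip \<longleftrightarrow>
     hilbert_function_space \<Omega> H ip \<and>
     (\<forall>x\<in>\<Omega>. kernel_section \<Omega> K x \<in> H \<and> (\<forall>f\<in>H. f x = ip f (kernel_section \<Omega> K x)))"

definition L2_functions :: "(real ^ 'd) set \<Rightarrow> (real ^ 'd \<Rightarrow> real) set" where
  "L2_functions \<Omega> =
     {f. f \<in> borel_measurable (lebesgue_on \<Omega>) \<and> integrable (lebesgue_on \<Omega>) (\<lambda>x. (f x)\<^sup>2)}"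

definition L2_norm_on :: "(real ^ 'd) set \<Rightarrow> (real ^ 'd \<Rightarrow> real) \<Rightarrow> real" where
  "L2_norm_on \<Omega> f = sqrt (LINT x|lebesgue_on \<Omega>. (f x)\<^sup>2)"

definition integral_operator ::
  "(real ^ 'd) set \<Rightarrow> (real ^ 'd \<Rightarrow> real ^ 'd \<Rightarrow> real) \<Rightarrow> (real ^ 'd \<Rightarrow> real) \<Rightarrow> real ^ 'd \<Rightarrow> real" where
  "integral_operator \<Omega> K f x = (LINT y|lebesgue_on \<Omega>. K x y * f y)"

definition L2_eigenspace ::
  "(real ^ 'd) set \<Rightarrow> (real ^ 'd \<Rightarrow> real ^ 'd \<Rightarrow> real) \<Rightarrow> real \<Rightarrow> (real ^ 'd \<Rightarrow> real) set" where
  "L2_eigenspace \<Omega> K \<mu> =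
     {f \<in> L2_functions \<Omega>. AE x in lebesgue_on \<Omega>. integral_operator \<Omega> K f x = \<mu> * f x}"

text \<open>
  The space of almost-everywhere classes of the functions in \<open>S\<close> has dimension \<open>m\<close>: linear
  independence and spanning are both understood almost everywhere.
\<close>

definition has_L2_dim :: "(real ^ 'd) set \<Rightarrow> (real ^ 'd \<Rightarrow> real) set \<Rightarrow> nat \<Rightarrow> bool" where
  "has_L2_dim \<Omega> S m \<longleftrightarrow>
     (\<exists>b::nat \<Rightarrow> real ^ 'd \<Rightarrow> real.
        (\<forall>i<m. b i \<in> S) \<and>
        (\<forall>c. (AE x in lebesgue_on \<Omega>. (\<Sum>i<m. c i * b i x) = 0) \<longrightarrow> (\<forall>i<m. c i = 0)) \<and>
        (\<forall>f\<in>S. \<exists>c. AE x in lebesgue_on \<Omega>. f x = (\<Sum>i<m. c i * b i x)))"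

text \<open>
  Eigenvalues and eigenfunctions are numbered from \<open>0\<close>: \<open>lam j\<close> stands for \<open>\<lambda>\<^sub>j\<^sub>+\<^sub>1\<close>. Each positive
  number \<open>\<mu>\<close> occurs in the sequence as often as its multiplicity, hence not at all if it is not
  an eigenvalue.
\<close>

definition positive_eigenvalues ::
  "(real ^ 'd) set \<Rightarrow> (real ^ 'd \<Rightarrow> real ^ 'd \<Rightarrow> real) \<Rightarrow> (nat \<Rightarrow> real) \<Rightarrow> bool" where
  "positive_eigenvalues \<Omega> K lam \<longleftrightarrow>
     decseq lam \<and> (\<forall>j. 0 < lam j) \<and>
     (\<forall>\<mu>>0. finite {j. lam j = \<mu>} \<and> has_L2_dim \<Omega> (L2_eigenspace \<Omega> K \<mu>) (card {j. lam j = \<mu>}))"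

definition orthonormal_eigenfunctions ::
  "(real ^ 'd) set \<Rightarrow> (real ^ 'd \<Rightarrow> real ^ 'd \<Rightarrow> real) \<Rightarrow> (real ^ 'd \<Rightarrow> real) set
     \<Rightarrow> (nat \<Rightarrow> real) \<Rightarrow> (nat \<Rightarrow> real ^ 'd \<Rightarrow> real) \<Rightarrow> bool" where
  "orthonormal_eigenfunctions \<Omega> K H lam \<phi> \<longleftrightarrow>
     (\<forall>j. \<phi> j \<in> H \<and> \<phi> j \<in> L2_eigenspace \<Omega> K (lam j)) \<and>
     (\<forall>i j. (LINT x|lebesgue_on \<Omega>. \<phi> i x * \<phi> j x) = (if i = j then 1 else 0))"

definition orthogonal_projector ::
  "(('a \<Rightarrow> real) \<Rightarrow> ('a \<Rightarrow> real) \<Rightarrow> real) \<Rightarrow> ('a \<Rightarrow> real) set \<Rightarrow> ('a \<Rightarrow> real) \<Rightarrow> 'a \<Rightarrow> real" where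
  "orthogonal_projector ip V f = (THE g. g \<in> V \<and> (\<forall>v\<in>V. ip (f - g) v = 0))"

text \<open>
  The supremum is that of a nonempty set of reals, bounded at \<open>x \<in> \<Omega>\<close> by \<open>sqrt (K x x)\<close> when
  \<open>(H, ip)\<close> is the native space of \<open>K\<close> and \<open>V\<close> is a finite-dimensional subspace of it.
\<close>

definition power_function ::
  "('a \<Rightarrow> real) set \<Rightarrow> (('a \<Rightarrow> real) \<Rightarrow> ('a \<Rightarrow> real) \<Rightarrow> real) \<Rightarrow> ('a \<Rightarrow> real) set \<Rightarrow> 'a \<Rightarrow> real" where
  "power_function H ip V x =
     (SUP f\<in>{f \<in> H. ip_norm ip f \<le> 1}. \<bar>f x - orthogonal_projector ip V f x\<bar>)"

text \<open>For \<open>n > 0\<close>, \<^prop>\<open>dim V = n\<close> entails that \<open>V\<close> is finite-dimensional.\<close>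

definition subspaces_of_dim :: "('a \<Rightarrow> real) set \<Rightarrow> nat \<Rightarrow> ('a \<Rightarrow> real) set set" where
  "subspaces_of_dim H n = {V. subspace V \<and> V \<subseteq> H \<and> dim V = n}"

definition power_width ::
  "(real ^ 'd) set \<Rightarrow> (real ^ 'd \<Rightarrow> real) set
     \<Rightarrow> ((real ^ 'd \<Rightarrow> real) \<Rightarrow> (real ^ 'd \<Rightarrow> real) \<Rightarrow> real) \<Rightarrow> nat \<Rightarrow> real" where
  "power_width \<Omega> H ip n =
     (INF V\<in>subspaces_of_dim H n. L2_norm_on \<Omega> (power_function H ip V))"

definition optimal_subspace ::
  "(real ^ 'd) set \<Rightarrow> (real ^ 'd \<Rightarrow> real) set
     \<Rightarrow> ((real ^ 'd \<Rightarrow> real) \<Rightarrow> (real ^ 'd \<Rightarrow> real) \<Rightarrow> real) \<Rightarrow> nat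
     \<Rightarrow> (real ^ 'd \<Rightarrow> real) set \<Rightarrow> bool" where
  "optimal_subspace \<Omega> H ip n V \<longleftrightarrow>
     V \<in> subspaces_of_dim H n \<and>
     L2_norm_on \<Omega> (power_function H ip V) = power_width \<Omega> H ip n"

end

theory Submission
  imports Defs "HOL-Complex_Analysis.Great_Picard"
begin

text \<open>
  The projection error at \<open>x\<close> is the functional \<open>f \<mapsto> (f, K\<^sub>x - \<Pi> K\<^sub>x)\<close> on the native space, where
  \<open>K\<^sub>x\<close> is the kernel section. Hence for an orthonormal basis \<open>v\<^sub>1, \<dots>, v\<^sub>n\<close> of \<open>V\<close> the squared power
  function is \<open>K(x,x) - (v\<^sub>1(x)\<^sup>2 + \<dots> + v\<^sub>n(x)\<^sup>2)\<close>, and after integration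
  \<open>\<parallel>P\<^sub>V\<parallel>\<^sup>2 = \<integral> K(x,x) dx - (\<parallel>v\<^sub>1\<parallel>\<^sup>2 + \<dots> + \<parallel>v\<^sub>n\<parallel>\<^sup>2)\<close> with \<open>L\<^sub>2\<close> norms on the right. Minimising over \<open>V\<close> means
  maximising the trace of the \<open>L\<^sub>2\<close> form over the \<open>n\<close>-dimensional subspaces of the native space. This
  is Ky Fan's problem for the compact positive operator that represents the \<open>L\<^sub>2\<close> form, and this
  operator is \<open>T\<close> itself: \<open>(Tf, g) = \<integral> f g\<close> for all \<open>g\<close> in the native space.

  For the spectral side only two inner products on one space matter: a complete one, \<open>ip\<close>, and a
  positive definite form \<open>b\<close> for which bounded sequences have \<open>b\<close>-Cauchy subsequences. A vector that
  maximises \<open>b f f\<close> on the unit sphere of a closed invariant subspace is an eigenvector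
  (\<open>eigenvector_exists\<close>); applied to the orthogonal complement of all eigenvectors, this shows that
  the vectors \<open>\<surd>\<lambda>\<^sub>j \<phi>\<^sub>j\<close> are a complete orthonormal system (\<open>eigenfamily_total\<close>). With the Parseval
  identities \<open>\<psi>_Parseval\<close>, the sum of the first \<open>n\<close> eigenvalues minus the trace over \<open>V\<close> is a
  series of nonnegative terms (\<open>Ky_Fan_sums\<close>). It vanishes only if \<open>V\<close> contains the eigenspaces above
  \<open>\<lambda>\<^sub>n\<close> and is orthogonal to those below, which leaves a choice inside the eigenspace of \<open>\<lambda>\<^sub>n\<close> and gives
  the uniqueness statement (\<open>Ky_Fan_equality\<close>).

  The native space meets these conditions: its unit ball is equicontinuous, so the Arzela-Ascoli
  theorem supplies the compactness, and full support makes the \<open>L\<^sub>2\<close> form definite on continuous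
  functions. An \<open>L\<^sub>2\<close> eigenfunction for a positive eigenvalue agrees almost everywhere with a member
  of the native space (\<open>L2_eigenspace_representative\<close>). Finally, Parseval for \<open>K\<^sub>x\<close> gives
  \<open>K(x,x) = \<Sum>\<^sub>j \<lambda>\<^sub>j \<phi>\<^sub>j(x)\<^sup>2\<close>, and integration shows that \<open>\<integral> K(x,x) dx\<close> is the sum of all eigenvalues
  (\<open>lam_sums_trace\<close>).
\<close>

section \<open>Inner products and orthonormal families\<close>

text \<open>
  The inner product is a parameter because two of them live on the same space of functions: the
  native one and the \<open>L\<^sub>2\<close> one, which is definite there but in general not complete.
\<close>

locale inner_product_subspace =
  fixes H :: "'a::real_vector set" and ip :: "'a \<Rightarrow> 'a \<Rightarrow> real"
  assumes subspace_H: "subspace H"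
    and ip_sym: "\<And>f g. \<lbrakk>f \<in> H; g \<in> H\<rbrakk> \<Longrightarrow> ip f g = ip g f"
    and ip_add_left: "\<And>f g h. \<lbrakk>f \<in> H; g \<in> H; h \<in> H\<rbrakk> \<Longrightarrow> ip (f + g) h = ip f h + ip g h"
    and ip_scale_left: "\<And>c f g. \<lbrakk>f \<in> H; g \<in> H\<rbrakk> \<Longrightarrow> ip (c *\<^sub>R f) g = c * ip f g"
    and ip_nonneg: "\<And>f. f \<in> H \<Longrightarrow> 0 \<le> ip f f"
    and ip_eq_0D: "\<And>f. \<lbrakk>f \<in> H; ip f f = 0\<rbrakk> \<Longrightarrow> f = 0"
begin

lemma mem_H [simp]:
  "0 \<in> H"
  "f \<in> H \<Longrightarrow> g \<in> H \<Longrightarrow> f + g \<in> H"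
  "f \<in> H \<Longrightarrow> g \<in> H \<Longrightarrow> f - g \<in> H"
  "f \<in> H \<Longrightarrow> c *\<^sub>R f \<in> H"
  using subspace_H by (auto simp: subspace_0 subspace_add subspace_diff subspace_scale)

lemma sum_mem_H [simp]: "(\<And>i. i \<in> I \<Longrightarrow> F i \<in> H) \<Longrightarrow> sum F I \<in> H"
  using subspace_H by (rule subspace_sum)

lemma ip_add_right:
  "\<lbrakk>f \<in> H; g \<in> H; h \<in> H\<rbrakk> \<Longrightarrow> ip h (f + g) = ip h f + ip h g"
  using ip_add_left[of f g h] by (simp add: ip_sym[of h])

lemma ip_scale_right: "\<lbrakk>f \<in> H; g \<in> H\<rbrakk> \<Longrightarrow> ip f (c *\<^sub>R g) = c * ip f g"
  using ip_scale_left[of g f c] by (simp add: ip_sym[of f])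

lemma ip_0 [simp]: "f \<in> H \<Longrightarrow> ip 0 f = 0" "f \<in> H \<Longrightarrow> ip f 0 = 0"
  using ip_scale_left[of f f 0] ip_scale_right[of f f 0] by auto

lemma ip_diff_left:
  "\<lbrakk>f \<in> H; g \<in> H; h \<in> H\<rbrakk> \<Longrightarrow> ip (f - g) h = ip f h - ip g h"
  using ip_add_left[of f "(-1) *\<^sub>R g" h] ip_scale_left[of g h "-1"] mem_H(4)[of g "-1"] by simp

lemma ip_diff_right:
  "\<lbrakk>f \<in> H; g \<in> H; h \<in> H\<rbrakk> \<Longrightarrow> ip h (f - g) = ip h f - ip h g"
  using ip_diff_left[of f g h] by (simp add: ip_sym[of h])

lemma ip_sum_left:
  "\<lbrakk>\<And>i. i \<in> I \<Longrightarrow> F i \<in> H; h \<in> H\<rbrakk> \<Longrightarrow> ip (sum F I) h = (\<Sum>i\<in>I. ip (F i) h)"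
  by (induction I rule: infinite_finite_induct) (auto simp: ip_add_left)

lemma ip_sum_right:
  "\<lbrakk>\<And>i. i \<in> I \<Longrightarrow> F i \<in> H; h \<in> H\<rbrakk> \<Longrightarrow> ip h (sum F I) = (\<Sum>i\<in>I. ip h (F i))"
  by (induction I rule: infinite_finite_induct) (auto simp: ip_add_right)

lemmas ip_linear = ip_add_left ip_add_right ip_scale_left ip_scale_right
  ip_diff_left ip_diff_right ip_sum_left ip_sum_right

lemma ip_pos: "f \<in> H \<Longrightarrow> f \<noteq> 0 \<Longrightarrow> 0 < ip f f"
  using ip_nonneg[of f] ip_eq_0D[of f] by force

lemma Cauchy_Schwarz:
  assumes "f \<in> H" "g \<in> H"
  shows "\<bar>ip f g\<bar> \<le> ip_norm ip f * ip_norm ip g"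
proof (cases "g = 0")
  case True
  then show ?thesis using assms by (simp add: ip_norm_def)
next
  case False
  then have p: "0 < ip g g" using assms ip_pos by blast
  let ?r = "ip g g *\<^sub>R f - ip f g *\<^sub>R g"
  have "0 \<le> ip ?r ?r" using assms by (intro ip_nonneg) auto
  also have "ip ?r ?r = ip g g * (ip f f * ip g g - (ip f g)\<^sup>2)"
    using assms ip_sym[of f g] by (simp add: ip_linear algebra_simps power2_eq_square)
  finally have "(ip f g)\<^sup>2 \<le> ip f f * ip g g"
    using p by (simp add: zero_le_mult_iff)
  then have "sqrt ((ip f g)\<^sup>2) \<le> sqrt (ip f f * ip g g)" by (rule real_sqrt_le_mono)
  then show ?thesis by (simp add: ip_norm_def real_sqrt_mult)
qed

lemma ip_norm_square: "f \<in> H \<Longrightarrow> (ip_norm ip f)\<^sup>2 = ip f f"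
  by (simp add: ip_norm_def ip_nonneg)

lemma parallelogram:
  assumes "f \<in> H" "g \<in> H"
  shows "ip (f - g) (f - g) = 2 * ip f f + 2 * ip g g - ip (f + g) (f + g)"
  using assms by (simp add: ip_linear algebra_simps)

definition orthonormal_on :: "'i set \<Rightarrow> ('i \<Rightarrow> 'a) \<Rightarrow> bool" where
  "orthonormal_on J e \<longleftrightarrow>
     (\<forall>j\<in>J. e j \<in> H) \<and> (\<forall>i\<in>J. \<forall>j\<in>J. ip (e i) (e j) = (if i = j then 1 else 0))"

lemma orthonormal_on_mem: "orthonormal_on J e \<Longrightarrow> j \<in> J \<Longrightarrow> e j \<in> H"
  by (simp add: orthonormal_on_def)

lemma orthonormal_on_ip:
  "orthonormal_on J e \<Longrightarrow> i \<in> J \<Longrightarrow> j \<in> J \<Longrightarrow> ip (e i) (e j) = (if i = j then 1 else 0)"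
  by (simp add: orthonormal_on_def)

lemma orthonormal_on_subset: "orthonormal_on J e \<Longrightarrow> I \<subseteq> J \<Longrightarrow> orthonormal_on I e"
  unfolding orthonormal_on_def by blast

definition expansion :: "'i set \<Rightarrow> ('i \<Rightarrow> 'a) \<Rightarrow> 'a \<Rightarrow> 'a" where
  "expansion J e f = (\<Sum>j\<in>J. ip f (e j) *\<^sub>R e j)"

lemma expansion_mem: "orthonormal_on J e \<Longrightarrow> expansion J e f \<in> H"
  unfolding expansion_def by (auto simp: orthonormal_on_mem)

lemma expansion_in_span: "expansion J e f \<in> span (e ` J)"
  unfolding expansion_def by (intro span_sum span_scale span_base) auto

lemma ip_expansion_basis:
  assumes "orthonormal_on J e" "finite J" "j \<in> J"
  shows "ip (expansion J e f) (e j) = ip f (e j)"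
proof -
  have "ip (expansion J e f) (e j) = (\<Sum>i\<in>J. ip f (e i) * ip (e i) (e j))"
    using assms unfolding expansion_def by (simp add: ip_linear orthonormal_on_mem)
  also have "\<dots> = (\<Sum>i\<in>J. if i = j then ip f (e i) else 0)"
    using assms by (intro sum.cong) (auto simp: orthonormal_on_ip)
  finally show ?thesis using assms by simp
qed

lemma residual_orthogonal:
  assumes "orthonormal_on J e" "finite J" "f \<in> H" "v \<in> span (e ` J)"
  shows "ip (f - expansion J e f) v = 0"
proof -
  let ?W = "{v \<in> H. ip (f - expansion J e f) v = 0}"
  have "subspace ?W"
    using assms by (auto simp: subspace_def ip_linear expansion_mem)
  moreover have "e ` J \<subseteq> ?W"
    using assms by (auto simp: ip_linear ip_expansion_basis expansion_mem orthonormal_on_mem)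
  ultimately have "span (e ` J) \<subseteq> ?W" by (intro span_minimal)
  with assms(4) show ?thesis by blast
qed

lemma span_orthonormal_subset_H: "orthonormal_on J e \<Longrightarrow> span (e ` J) \<subseteq> H"
  by (rule span_minimal[OF _ subspace_H]) (auto simp: orthonormal_on_mem)

lemma ip_residual:
  assumes "orthonormal_on J e" "finite J" "f \<in> H"
  shows "ip (f - expansion J e f) (f - expansion J e f) = ip f f - (\<Sum>j\<in>J. (ip f (e j))\<^sup>2)"
proof -
  have "ip (f - expansion J e f) (f - expansion J e f) = ip (f - expansion J e f) f"
    using assms residual_orthogonal[OF assms expansion_in_span]
    by (subst ip_diff_right) (auto simp: expansion_mem)
  also have "\<dots> = ip f f - ip f (expansion J e f)"
    using assms by (simp add: ip_linear expansion_mem ip_sym[of f "expansion J e f"])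
  also have "ip f (expansion J e f) = (\<Sum>j\<in>J. (ip f (e j))\<^sup>2)"
    using assms unfolding expansion_def by (simp add: ip_linear orthonormal_on_mem power2_eq_square)
  finally show ?thesis .
qed

lemma Bessel:
  assumes "orthonormal_on J e" "finite J" "f \<in> H"
  shows "(\<Sum>j\<in>J. (ip f (e j))\<^sup>2) \<le> ip f f"
  using ip_residual[OF assms] assms ip_nonneg[of "f - expansion J e f"] by (simp add: expansion_mem)

lemma in_span_if_Bessel_equality:
  assumes "orthonormal_on J e" "finite J" "f \<in> H" "(\<Sum>j\<in>J. (ip f (e j))\<^sup>2) = ip f f"
  shows "f \<in> span (e ` J)"
proof -
  have "f - expansion J e f = 0"
    using assms by (intro ip_eq_0D) (auto simp: ip_residual expansion_mem)
  then show ?thesis using expansion_in_span[of J e f] by simp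
qed

lemma orthonormal_on_independent:
  assumes "orthonormal_on J e"
  shows "independent (e ` J)" "inj_on e J"
proof -
  have notin: "e j \<notin> span (e ` (J - {j}))" if j: "j \<in> J" for j
  proof
    assume "e j \<in> span (e ` (J - {j}))"
    moreover have "span (e ` (J - {j})) \<subseteq> {v \<in> H. ip v (e j) = 0}"
      using assms j
      by (intro span_minimal) (auto simp: subspace_def ip_linear orthonormal_on_mem orthonormal_on_ip)
    ultimately have "ip (e j) (e j) = 0" by blast
    with assms j show False by (simp add: orthonormal_on_ip)
  qed
  show "independent (e ` J)"
    unfolding dependent_def
  proof
    assume "\<exists>a\<in>e ` J. a \<in> span (e ` J - {a})"
    then obtain j where j: "j \<in> J" "e j \<in> span (e ` J - {e j})" by blast
    have "e ` J - {e j} \<subseteq> e ` (J - {j})" by auto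
    with j notin show False using span_mono by blast
  qed
  show "inj_on e J"
  proof (rule inj_onI, rule ccontr)
    fix i j assume *: "i \<in> J" "j \<in> J" "e i = e j" "i \<noteq> j"
    then have "ip (e i) (e j) = ip (e i) (e i)" by simp
    moreover have "ip (e i) (e j) = 0" "ip (e i) (e i) = 1"
      using * orthonormal_on_ip[OF assms, of i j] orthonormal_on_ip[OF assms, of i i] by simp_all
    ultimately show False by simp
  qed
qed

text \<open>
  Gram-Schmidt, in a form that keeps a given part of the basis. The index set is an arbitrary finite
  set so that a basis of an eigenspace can be indexed by the positions of its eigenvalue in the
  sequence of all eigenvalues.
\<close>

lemma orthonormal_extension:
  assumes "finite J" "I \<subseteq> J" "orthonormal_on I e" "e ` I \<subseteq> V"
    and V: "V \<subseteq> H" "subspace V" "finite B" "V \<subseteq> span B" and dim: "dim V = card J"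
  obtains e' where "\<And>i. i \<in> I \<Longrightarrow> e' i = e i" "orthonormal_on J e'" "span (e' ` J) = V"
proof -
  obtain B0 where B0: "B0 \<subseteq> V" "independent B0" "V \<subseteq> span B0" "card B0 = dim V"
    by (rule basis_exists)
  have finB0: "finite B0"
    using independent_span_bound[OF V(3) B0(2) subset_trans[OF B0(1) V(4)]] by (rule conjunct1)
  have "\<exists>e'. (\<forall>i\<in>I. e' i = e i) \<and> orthonormal_on J e' \<and> span (e' ` J) = V"
    using assms(2-4)
  proof (induction "card (J - I)" arbitrary: I e)
    case 0
    then have "J - I = {}" using \<open>finite J\<close> by simp
    with 0 have IJ: "I = J" by blast
    have sub: "span (e ` J) \<subseteq> V" using 0(4) IJ by (intro span_minimal[OF _ V(2)]) simp
    have "V \<subseteq> span (e ` J)"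
    proof
      fix v assume v: "v \<in> V"
      show "v \<in> span (e ` J)"
      proof (rule ccontr)
        assume n: "v \<notin> span (e ` J)"
        then have ind: "independent (insert v (e ` J))"
          using orthonormal_on_independent(1)[OF 0(3)] IJ by (intro independent_insertI) simp_all
        have "insert v (e ` J) \<subseteq> span B0"
          using v B0(3) 0(4) IJ by (metis insert_subset subset_trans in_mono)
        then have "card (insert v (e ` J)) \<le> card B0"
          by (rule conjunct2[OF independent_span_bound[OF finB0 ind]])
        moreover have "v \<notin> e ` J" using n span_base[of v "e ` J"] by blast
        moreover have "card (e ` J) = card J"
          using orthonormal_on_independent(2)[OF 0(3)] IJ by (simp add: card_image)
        moreover have "finite (e ` J)" using \<open>finite J\<close> by simp
        ultimately show False using B0(4) dim by (metis card_insert_disjoint not_less_eq_eq order_refl)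
      qed
    qed
    with sub have "span (e ` J) = V" by (rule equalityI)
    then show ?case using 0(3) IJ by (intro exI[of _ e]) simp
  next
    case (Suc k)
    have finI: "finite I" using Suc.prems \<open>finite J\<close> finite_subset by blast
    obtain j where j: "j \<in> J" "j \<notin> I"
    proof -
      have "J - I \<noteq> {}" using Suc.hyps(2) by force
      then show ?thesis using that by blast
    qed
    have "\<not> V \<subseteq> span (e ` I)"
    proof
      assume "V \<subseteq> span (e ` I)"
      then have "dim V \<le> card (e ` I)" using finI by (intro dim_le_card) auto
      also have "\<dots> \<le> card I" using finI by (rule card_image_le)
      also have "\<dots> < card J"
        using Suc.prems(1) j \<open>finite J\<close> by (intro psubset_card_mono) auto
      finally show False using dim by simp
    qed
    then obtain v where v: "v \<in> V" "v \<notin> span (e ` I)" by blast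
    define r where "r = v - expansion I e v"
    have sp: "span (e ` I) \<subseteq> V" using Suc.prems V by (intro span_minimal) auto
    have rV: "r \<in> V" unfolding r_def using v sp expansion_in_span[of I e v] by (intro subspace_diff[OF V(2)]) auto
    then have rH: "r \<in> H" using V by blast
    have "r \<noteq> 0" using v expansion_in_span[of I e v] by (auto simp: r_def)
    then have p: "0 < ip r r" using rH ip_pos by blast
    define e1 where "e1 = e(j := (1 / ip_norm ip r) *\<^sub>R r)"
    have orth: "ip r (e i) = 0" if "i \<in> I" for i
      unfolding r_def using that v V finI Suc.prems
      by (intro residual_orthogonal) (auto intro: span_base)
    have one: "ip ((1 / ip_norm ip r) *\<^sub>R r) ((1 / ip_norm ip r) *\<^sub>R r) = 1"
      using p rH by (simp add: ip_linear ip_norm_def)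
    have o1: "orthonormal_on (insert j I) e1"
      unfolding orthonormal_on_def
    proof (intro conjI ballI)
      fix i assume "i \<in> insert j I"
      then show "e1 i \<in> H" using Suc.prems rH by (auto simp: e1_def orthonormal_on_mem)
    next
      fix i i' assume i: "i \<in> insert j I" "i' \<in> insert j I"
      have eH: "e i \<in> H" if "i \<in> I" for i using that Suc.prems by (simp add: orthonormal_on_mem)
      have orth': "ip (e i) r = 0" if "i \<in> I" for i
        using orth[OF that] ip_sym[OF eH[OF that] rH] by simp
      show "ip (e1 i) (e1 i') = (if i = i' then 1 else 0)"
      proof (cases "i = j"; cases "i' = j")
        assume "i = j" "i' = j"
        then show ?thesis using one by (simp add: e1_def)
      next
        assume "i = j" "i' \<noteq> j"
        then show ?thesis using i orth rH eH by (simp add: e1_def ip_scale_left)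
      next
        assume "i \<noteq> j" "i' = j"
        then show ?thesis using i orth' rH eH by (simp add: e1_def ip_scale_right)
      next
        assume "i \<noteq> j" "i' \<noteq> j"
        then show ?thesis using i Suc.prems by (simp add: e1_def orthonormal_on_ip)
      qed
    qed
    have "card (J - insert j I) = k"
      using Suc.hyps(2) j \<open>finite J\<close> by (simp add: card_Diff_insert)
    moreover have "e1 ` insert j I \<subseteq> V"
      using Suc.prems rV V by (auto simp: e1_def subspace_scale)
    ultimately obtain e' where "\<forall>i\<in>insert j I. e' i = e1 i" "orthonormal_on J e'" "span (e' ` J) = V"
      using Suc.hyps(1)[of "insert j I" e1] Suc.prems(1) j(1) o1 by auto
    moreover from this(1) have "\<forall>i\<in>I. e' i = e i" using j by (auto simp: e1_def)
    ultimately show ?case by blast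
  qed
  then show ?thesis using that by blast
qed

end

section \<open>Riesz representation and Fourier expansions\<close>

text \<open>
  First-order optimality: a quadratic polynomial in \<open>t\<close> that has its minimum \<open>0\<close> at \<open>t = 0\<close> has no
  linear term. This yields the Euler equations of both variational arguments below.
\<close>

lemma linear_coefficient_zero:
  fixes a c :: real
  assumes "\<And>t. 0 \<le> 2 * t * a + t\<^sup>2 * c"
  shows "a = 0"
proof (rule ccontr)
  assume "a \<noteq> 0"
  define d where "d = \<bar>c\<bar> + 1"
  have d: "d > 0" "c < d" by (auto simp: d_def)
  \<comment> \<open>with \<open>d > c\<close>, the value at \<open>t = - a / d\<close> is negative unless \<open>a = 0\<close>\<close>
  have "0 \<le> 2 * (- a / d) * a + (- a / d)\<^sup>2 * c" by (rule assms)
  also have "\<dots> = (a\<^sup>2 / d) * (c / d - 2)"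
    using d by (simp add: field_simps power2_eq_square)
  finally have "0 \<le> (a\<^sup>2 / d) * (c / d - 2)" .
  moreover have "0 < a\<^sup>2 / d" using d \<open>a \<noteq> 0\<close> by simp
  ultimately have "0 \<le> c / d - 2" by (simp only: zero_le_mult_iff) linarith
  then show False using d by (simp add: field_simps)
qed

locale hilbert_subspace = inner_product_subspace +
  assumes complete: "\<And>F :: nat \<Rightarrow> 'a. \<lbrakk>range F \<subseteq> H;
      \<And>e. e > 0 \<Longrightarrow> \<exists>N. \<forall>m\<ge>N. \<forall>n\<ge>N. ip_norm ip (F m - F n) < e\<rbrakk>
      \<Longrightarrow> \<exists>f\<in>H. (\<lambda>n. ip_norm ip (F n - f)) \<longlonglongrightarrow> 0"
begin

lemma tendsto_ip_left:
  assumes "range F \<subseteq> H" "f \<in> H" "g \<in> H" "(\<lambda>n::nat. ip_norm ip (F n - f)) \<longlonglongrightarrow> 0"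
  shows "(\<lambda>n. ip (F n) g) \<longlonglongrightarrow> ip f g"
proof -
  have F: "F n \<in> H" for n using assms(1) by blast
  have "(\<lambda>n. ip (F n - f) g) \<longlonglongrightarrow> 0"
  proof (rule Lim_null_comparison)
    show "\<forall>\<^sub>F n in sequentially. norm (ip (F n - f) g) \<le> ip_norm ip (F n - f) * ip_norm ip g"
      using assms F by (intro always_eventually allI) (auto intro!: Cauchy_Schwarz)
    show "(\<lambda>n. ip_norm ip (F n - f) * ip_norm ip g) \<longlonglongrightarrow> 0"
      using tendsto_mult[OF assms(4) tendsto_const] by simp
  qed
  then have "(\<lambda>n. ip (F n) g - ip f g) \<longlonglongrightarrow> 0" using assms F by (simp add: ip_linear)
  then show ?thesis by (rule LIM_zero_cancel)
qed

lemma Cauchy_limit: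
  assumes F: "\<And>n::nat. F n \<in> H"
    and bd: "\<And>e::real. e > 0 \<Longrightarrow> \<exists>N. \<forall>m\<ge>N. \<forall>n\<ge>N. ip (F m - F n) (F m - F n) < e"
  obtains f where "f \<in> H" "(\<lambda>n. ip_norm ip (F n - f)) \<longlonglongrightarrow> 0"
proof -
  have "\<exists>f\<in>H. (\<lambda>n. ip_norm ip (F n - f)) \<longlonglongrightarrow> 0"
  proof (rule complete)
    show "range F \<subseteq> H" using F by blast
    fix e :: real assume "e > 0"
    then obtain N where N: "\<forall>m\<ge>N. \<forall>n\<ge>N. ip (F m - F n) (F m - F n) < e\<^sup>2"
      using bd[of "e\<^sup>2"] by auto
    have "ip_norm ip (F m - F n) < e" if "m \<ge> N" "n \<ge> N" for m n
      unfolding ip_norm_def using N that \<open>e > 0\<close> by (intro real_less_lsqrt) auto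
    then show "\<exists>N. \<forall>m\<ge>N. \<forall>n\<ge>N. ip_norm ip (F m - F n) < e" by blast
  qed
  then show ?thesis using that by blast
qed

text \<open>
  The representing element minimises \<open>J(g) = ip g g - 2 L g\<close>. The parallelogram law makes every
  minimising sequence Cauchy, and its limit satisfies the Euler equation \<open>ip h g = L g\<close>.
\<close>

lemma Riesz_representation:
  assumes add: "\<And>f g. \<lbrakk>f \<in> H; g \<in> H\<rbrakk> \<Longrightarrow> L (f + g) = L f + L g"
    and scale: "\<And>c f. f \<in> H \<Longrightarrow> L (c *\<^sub>R f) = c * L f"
    and bound: "\<And>f. f \<in> H \<Longrightarrow> \<bar>L f\<bar> \<le> C * ip_norm ip f"
  obtains h where "h \<in> H" "\<And>g. g \<in> H \<Longrightarrow> ip h g = L g"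
proof -
  define J where "J g = ip g g - 2 * L g" for g
  have lb: "- C\<^sup>2 \<le> J g" if "g \<in> H" for g
  proof -
    have "2 * L g \<le> 2 * (C * ip_norm ip g)" using bound[OF that] by simp
    also have "\<dots> \<le> C\<^sup>2 + (ip_norm ip g)\<^sup>2"
      using sum_squares_bound[of C "ip_norm ip g"] by (simp add: algebra_simps)
    finally show ?thesis using that by (simp add: J_def ip_norm_square)
  qed
  define m where "m = (INF g\<in>H. J g)"
  have bdd: "bdd_below (J ` H)" using lb by (intro bdd_belowI2)
  have ne: "J ` H \<noteq> {}" using mem_H(1) by blast
  have mle: "m \<le> J g" if "g \<in> H" for g
    unfolding m_def using bdd that by (intro cINF_lower)
  have "\<exists>g\<in>H. J g < m + 1 / (1 + real k)" for k
  proof (rule ccontr)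
    assume "\<not> ?thesis"
    then have "m + 1 / (1 + real k) \<le> m" 
      unfolding m_def by (intro cINF_greatest) (use ne in \<open>auto simp: m_def not_less\<close>)
    then show False by (simp add: field_simps)
  qed
  then obtain F where F: "\<And>k. F k \<in> H" "\<And>k. J (F k) < m + 1 / (1 + real k)" by metis
  have conv: "(\<lambda>k. 1 / (1 + real k)) \<longlonglongrightarrow> 0"
    using LIMSEQ_inverse_real_of_nat by (simp add: inverse_eq_divide add.commute)
  have diff: "ip (f - g) (f - g) \<le> 2 * (J f - m) + 2 * (J g - m)" if fg: "f \<in> H" "g \<in> H" for f g
  proof -
    have "4 * m \<le> 4 * J ((1/2) *\<^sub>R (f + g))" using mle[of "(1/2) *\<^sub>R (f + g)"] fg by simp
    also have "\<dots> = ip (f + g) (f + g) - 4 * L f - 4 * L g"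
      using fg by (simp add: J_def ip_scale_left ip_scale_right add scale add_divide_distrib)
    finally show ?thesis using parallelogram[OF fg] by (simp add: J_def)
  qed
  obtain h where h: "h \<in> H" "(\<lambda>n. ip_norm ip (F n - h)) \<longlonglongrightarrow> 0"
  proof (rule Cauchy_limit)
    show "F k \<in> H" for k by (rule F)
    fix e :: real assume "e > 0"
    then have "\<forall>\<^sub>F k in sequentially. 1 / (1 + real k) < e / 4"
      using conv by (intro order_tendstoD) auto
    then obtain N where N: "\<And>k. k \<ge> N \<Longrightarrow> 1 / (1 + real k) < e / 4"
      by (auto simp: eventually_sequentially)
    have "ip (F k - F l) (F k - F l) < e" if "k \<ge> N" "l \<ge> N" for k l
    proof -
      have "J (F k) - m < e / 4" "J (F l) - m < e / 4"
        using F(2)[of k] F(2)[of l] N[OF that(1)] N[OF that(2)] by auto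
      with diff[OF F(1)[of k] F(1)[of l]] show ?thesis by argo
    qed
    then show "\<exists>N. \<forall>k\<ge>N. \<forall>l\<ge>N. ip (F k - F l) (F k - F l) < e" by blast
  qed auto
  have "ip h g = L g" if g: "g \<in> H" for g
  proof -
    have "0 \<le> 2 * t * (ip h g - L g) + t\<^sup>2 * ip g g" for t
    proof -
      have "(\<lambda>k. 1 / (1 + real k) + 2 * t * (ip (F k) g - L g) + t\<^sup>2 * ip g g)
            \<longlonglongrightarrow> 0 + 2 * t * (ip h g - L g) + t\<^sup>2 * ip g g"
        using F h g by (intro tendsto_intros conv tendsto_ip_left) auto
      moreover have "0 \<le> 1 / (1 + real k) + 2 * t * (ip (F k) g - L g) + t\<^sup>2 * ip g g" for k
      proof -
        have "m \<le> J (F k + t *\<^sub>R g)" using F g by (intro mle) auto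
        also have "\<dots> = J (F k) + 2 * t * (ip (F k) g - L g) + t\<^sup>2 * ip g g"
          using F(1)[of k] g ip_sym[of g "F k"]
          by (simp add: J_def ip_add_left ip_add_right ip_scale_left ip_scale_right add scale algebra_simps power2_eq_square)
        finally show ?thesis using F(2)[of k] by linarith
      qed
      ultimately have "0 \<le> 0 + 2 * t * (ip h g - L g) + t\<^sup>2 * ip g g"
        by (intro LIMSEQ_le_const) auto
      then show ?thesis by simp
    qed
    then have "ip h g - L g = 0" by (rule linear_coefficient_zero)
    then show ?thesis by simp
  qed
  with h that show ?thesis by blast
qed

text \<open>
  Bessel's inequality makes the partial sums Cauchy; \<open>f\<close> minus their limit is orthogonal to the whole
  system, so totality forces it to vanish.
\<close>

lemma complete_orthonormal_expansion:
  fixes e :: "nat \<Rightarrow> 'a"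
  assumes e: "orthonormal_on UNIV e"
    and total: "\<And>f. \<lbrakk>f \<in> H; \<And>j. ip f (e j) = 0\<rbrakk> \<Longrightarrow> f = 0"
    and f: "f \<in> H"
  shows "(\<lambda>N. ip_norm ip (f - expansion {..<N} e f)) \<longlonglongrightarrow> 0"
proof -
  have eN: "orthonormal_on J e" for J using e orthonormal_on_subset by blast
  define F where "F N = expansion {..<N} e f" for N
  have FH: "F N \<in> H" for N unfolding F_def by (rule expansion_mem[OF eN])
  let ?c = "\<lambda>j. (ip f (e j))\<^sup>2"
  have "summable ?c"
    using Bessel[OF eN, of "{..<n}" f for n] f by (intro summableI_nonneg_bounded) auto
  then have C: "Cauchy (\<lambda>N. \<Sum>j<N. ?c j)"
    by (simp add: summable_iff_convergent Cauchy_convergent_iff)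
  have diff: "ip (F M - F N) (F M - F N) = (\<Sum>j<M. ?c j) - (\<Sum>j<N. ?c j)" if "N \<le> M" for M N
  proof -
    have "F M - F N = expansion {N..<M} e f"
      using that by (simp add: F_def expansion_def lessThan_atLeast0 sum_diff_nat_ivl)
    moreover have "ip (expansion {N..<M} e f) (expansion {N..<M} e f) = (\<Sum>j\<in>{N..<M}. ?c j)"
    proof -
      have "ip (expansion {N..<M} e f) (expansion {N..<M} e f)
            = (\<Sum>j\<in>{N..<M}. ip f (e j) * ip (expansion {N..<M} e f) (e j))"
        unfolding expansion_def[of "{N..<M}" e f]
        by (subst ip_sum_right)
          (auto simp: ip_scale_right orthonormal_on_mem[OF e] expansion_mem[OF eN] simp flip: expansion_def)
      then show ?thesis by (simp add: ip_expansion_basis[OF eN] power2_eq_square)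
    qed
    ultimately show ?thesis using that by (simp add: lessThan_atLeast0 sum_diff_nat_ivl)
  qed
  obtain g where g: "g \<in> H" "(\<lambda>n. ip_norm ip (F n - g)) \<longlonglongrightarrow> 0"
  proof (rule Cauchy_limit)
    show "F N \<in> H" for N by (rule FH)
    fix d :: real assume "d > 0"
    then obtain N where N: "\<forall>m\<ge>N. \<forall>n\<ge>N. norm ((\<Sum>j<m. ?c j) - (\<Sum>j<n. ?c j)) < d"
      using CauchyD[OF C] by blast
    have "ip (F m - F n) (F m - F n) < d" if "m \<ge> N" "n \<ge> N" for m n
    proof (cases "n \<le> m")
      case True
      have "norm ((\<Sum>j<m. ?c j) - (\<Sum>j<n. ?c j)) < d" using N that by blast
      then show ?thesis using diff[OF True] by simp
    next
      case False
      have "norm ((\<Sum>j<n. ?c j) - (\<Sum>j<m. ?c j)) < d" using N that by blast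
      moreover have "ip (F m - F n) (F m - F n) = ip (F n - F m) (F n - F m)"
        using FH by (simp add: ip_linear)
      ultimately show ?thesis using diff[of m n] False by simp
    qed
    then show "\<exists>N. \<forall>m\<ge>N. \<forall>n\<ge>N. ip (F m - F n) (F m - F n) < d" by blast
  qed auto
  have "f - g = 0"
  proof (rule total)
    show "f - g \<in> H" using f g by simp
    fix j
    have "(\<lambda>N. ip (F N) (e j)) \<longlonglongrightarrow> ip g (e j)"
      using FH g by (intro tendsto_ip_left) (auto simp: orthonormal_on_mem[OF e])
    moreover have "\<forall>\<^sub>F N in sequentially. ip (F N) (e j) = ip f (e j)"
      using eventually_gt_at_top[of j]
      by eventually_elim (simp add: F_def ip_expansion_basis[OF eN])
    ultimately have "ip g (e j) = ip f (e j)"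
      by (metis LIMSEQ_unique tendsto_eventually)
    then show "ip (f - g) (e j) = 0" using f g by (simp add: ip_linear orthonormal_on_mem[OF e])
  qed
  then have "ip_norm ip (F n - g) = ip_norm ip (f - expansion {..<n} e f)" for n
    using FH[of n] f by (simp add: ip_norm_def ip_linear F_def)
  with g show ?thesis by simp
qed

end

section \<open>Eigenvectors of a compact form\<close>

lemma span_scaled_family:
  fixes \<phi> :: "'i \<Rightarrow> 'a::real_vector"
  assumes "\<And>j. j \<in> J \<Longrightarrow> c j \<noteq> 0"
  shows "span ((\<lambda>j. c j *\<^sub>R \<phi> j) ` J) = span (\<phi> ` J)"
proof
  show "span ((\<lambda>j. c j *\<^sub>R \<phi> j) ` J) \<subseteq> span (\<phi> ` J)"
    by (intro span_minimal) (auto intro: span_scale span_base)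
  show "span (\<phi> ` J) \<subseteq> span ((\<lambda>j. c j *\<^sub>R \<phi> j) ` J)"
  proof (intro span_minimal subspace_span image_subsetI)
    fix j assume j: "j \<in> J"
    then have "(1 / c j) *\<^sub>R (c j *\<^sub>R \<phi> j) \<in> span ((\<lambda>j. c j *\<^sub>R \<phi> j) ` J)"
      by (intro span_scale span_base) blast
    then show "\<phi> j \<in> span ((\<lambda>j. c j *\<^sub>R \<phi> j) ` J)" using assms[OF j] by simp
  qed
qed

text \<open>
  The form \<open>b\<close> plays the role of a compact positive definite operator \<open>A\<close> through
  \<open>b f g = ip (A f) g\<close>. Compactness only asks for \<open>b\<close>-Cauchy subsequences, as \<open>H\<close> need not be complete
  with respect to \<open>b\<close>.
\<close>

locale compact_form_pair = hilbert_subspace H ip + b: inner_product_subspace H b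
  for H :: "'a::real_vector set" and ip b +
  fixes C :: real
  assumes bounded: "\<And>f. f \<in> H \<Longrightarrow> b f f \<le> C * ip f f"
    and compact_form: "\<And>F :: nat \<Rightarrow> 'a. \<lbrakk>\<And>k. F k \<in> H; \<And>k. ip (F k) (F k) \<le> 1\<rbrakk> \<Longrightarrow>
      \<exists>r :: nat \<Rightarrow> nat. strict_mono r \<and>
        (\<forall>e>0. \<exists>N. \<forall>m\<ge>N. \<forall>n\<ge>N. b (F (r m) - F (r n)) (F (r m) - F (r n)) < e)"
begin

lemma form_representation:
  assumes f: "f \<in> H"
  obtains h where "h \<in> H" "\<And>g. g \<in> H \<Longrightarrow> ip h g = b f g"
proof -
  have bound: "\<bar>b f g\<bar> \<le> (ip_norm b f * sqrt C) * ip_norm ip g" if g: "g \<in> H" for g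
  proof -
    have "ip_norm b g \<le> sqrt C * ip_norm ip g"
      unfolding ip_norm_def using bounded[OF g] by (simp flip: real_sqrt_mult)
    then have "ip_norm b f * ip_norm b g \<le> ip_norm b f * (sqrt C * ip_norm ip g)"
      using b.ip_nonneg[OF f] by (intro mult_left_mono) (auto simp: ip_norm_def)
    with b.Cauchy_Schwarz[OF f g] show ?thesis by (simp add: mult.assoc)
  qed
  obtain h where "h \<in> H" "\<And>g. g \<in> H \<Longrightarrow> ip h g = b f g"
    using Riesz_representation[of "b f" "ip_norm b f * sqrt C"] f bound
    by (metis b.ip_add_right b.ip_scale_right)
  with that show ?thesis by blast
qed

definition eigenspace :: "real \<Rightarrow> 'a set" where
  "eigenspace \<mu> = {f \<in> H. \<forall>g\<in>H. b f g = \<mu> * ip f g}"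

lemma eigenspaceD: "f \<in> eigenspace \<mu> \<Longrightarrow> f \<in> H" "f \<in> eigenspace \<mu> \<Longrightarrow> g \<in> H \<Longrightarrow> b f g = \<mu> * ip f g"
  by (auto simp: eigenspace_def)

lemma eigenspaceD': "f \<in> eigenspace \<mu> \<Longrightarrow> g \<in> H \<Longrightarrow> b g f = \<mu> * ip g f"
  using eigenspaceD(1)[of f \<mu>] eigenspaceD(2)[of f \<mu> g] by (simp add: ip_sym[of f g] b.ip_sym[of f g])

lemma subspace_eigenspace: "subspace (eigenspace \<mu>)"
  by (auto simp: subspace_def eigenspace_def ip_linear b.ip_linear algebra_simps)

lemma eigenspaces_orthogonal:
  assumes "f \<in> eigenspace \<mu>" "g \<in> eigenspace \<nu>" "\<mu> \<noteq> \<nu>"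
  shows "ip f g = 0" "b f g = 0"
proof -
  have "\<mu> * ip f g = \<nu> * ip f g"
    using eigenspaceD(2)[OF assms(1) eigenspaceD(1)[OF assms(2)]]
      eigenspaceD'[OF assms(2) eigenspaceD(1)[OF assms(1)]] by (rule trans[OF sym])
  then show "ip f g = 0" using assms(3) mult_cancel_right by blast
  with eigenspaceD(2)[OF assms(1) eigenspaceD(1)[OF assms(2)]] show "b f g = 0" by simp
qed

text \<open>
  Boundedness makes \<open>b\<close> continuous in the \<open>ip\<close> norm, so both quadratic forms pass to the limit.
\<close>

lemma tendsto_form:
  assumes F: "\<And>n::nat. F n \<in> H" and f: "f \<in> H" and lim: "(\<lambda>n. ip_norm ip (F n - f)) \<longlonglongrightarrow> 0"
  shows "(\<lambda>n. b (F n) (F n)) \<longlonglongrightarrow> b f f" "(\<lambda>n. ip (F n) (F n)) \<longlonglongrightarrow> ip f f"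
proof -
  have sq: "(\<lambda>n. ip (F n - f) (F n - f)) \<longlonglongrightarrow> 0"
    using tendsto_power[OF lim, of 2] F f by (simp add: ip_norm_square)
  have bsq: "(\<lambda>n. b (F n - f) (F n - f)) \<longlonglongrightarrow> 0"
  proof (rule tendsto_sandwich[OF _ _ tendsto_const])
    show "(\<lambda>n. C * ip (F n - f) (F n - f)) \<longlonglongrightarrow> 0"
      using tendsto_mult[OF tendsto_const sq, of C] by simp
  qed (use F f b.ip_nonneg bounded in auto)
  obtain h where h: "h \<in> H" "\<And>g. g \<in> H \<Longrightarrow> ip h g = b f g"
    using form_representation[OF f] by blast
  have "(\<lambda>n. b (F n) f) \<longlonglongrightarrow> b f f"
  proof -
    have "(\<lambda>n. ip (F n) h) \<longlonglongrightarrow> ip f h"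
      using F by (intro tendsto_ip_left[OF _ f h(1) lim]) auto
    moreover have "ip g h = b g f" if "g \<in> H" for g
      using h(2)[OF that] ip_sym[OF h(1) that] b.ip_sym[OF f that] by simp
    ultimately show ?thesis using F f by simp
  qed
  then have "(\<lambda>n. b (F n - f) (F n - f) + 2 * b (F n) f - b f f) \<longlonglongrightarrow> 0 + 2 * b f f - b f f"
    by (intro tendsto_intros bsq)
  moreover have "b (F n - f) (F n - f) + 2 * b (F n) f - b f f = b (F n) (F n)" for n
    using F[of n] f b.ip_sym[of f "F n"] by (simp add: b.ip_linear)
  ultimately show "(\<lambda>n. b (F n) (F n)) \<longlonglongrightarrow> b f f" by simp
  have "(\<lambda>n. ip (F n) f) \<longlonglongrightarrow> ip f f"
    using F by (intro tendsto_ip_left[OF _ f f lim]) auto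
  then have "(\<lambda>n. ip (F n - f) (F n - f) + 2 * ip (F n) f - ip f f) \<longlonglongrightarrow> 0 + 2 * ip f f - ip f f"
    by (intro tendsto_intros sq)
  moreover have "ip (F n - f) (F n - f) + 2 * ip (F n) f - ip f f = ip (F n) (F n)" for n
    using F[of n] f ip_sym[of f "F n"] by (simp add: ip_linear)
  ultimately show "(\<lambda>n. ip (F n) (F n)) \<longlonglongrightarrow> ip f f" by simp
qed

text \<open>
  A maximising sequence of unit vectors has a \<open>b\<close>-Cauchy subsequence. That it is then \<open>ip\<close>-Cauchy
  follows by comparing the parallelogram laws of the two forms: \<open>b (f + g) (f + g)\<close> is close to \<open>4 \<sigma>\<close>
  and at most \<open>\<sigma> * ip (f + g) (f + g)\<close>, which leaves no room for \<open>ip (f - g) (f - g)\<close>.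
\<close>

lemma maximizer_exists:
  assumes M: "M \<subseteq> H" "subspace M" "M \<noteq> {0}"
    and closed: "\<forall>F f. (\<forall>k::nat. F k \<in> M) \<and> f \<in> H \<and> (\<lambda>k. ip_norm ip (F k - f)) \<longlonglongrightarrow> 0 \<longrightarrow> f \<in> M"
  obtains f \<sigma> where "f \<in> M" "f \<noteq> 0" "\<sigma> > 0" "b f f = \<sigma> * ip f f"
    "\<And>g. g \<in> M \<Longrightarrow> b g g \<le> \<sigma> * ip g g"
proof -
  define S where "S = {f \<in> M. ip f f = 1}"
  define \<sigma> where "\<sigma> = (SUP f\<in>S. b f f)"
  have normalise: "(1 / ip_norm ip f) *\<^sub>R f \<in> S"
    "b ((1 / ip_norm ip f) *\<^sub>R f) ((1 / ip_norm ip f) *\<^sub>R f) = b f f / ip f f"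
    if "f \<in> M" "f \<noteq> 0" for f
  proof -
    have f: "f \<in> H" using that M by blast
    then have p: "0 < ip f f" using that ip_pos by blast
    then have "ip ((1 / ip_norm ip f) *\<^sub>R f) ((1 / ip_norm ip f) *\<^sub>R f) = 1"
      using f by (simp add: ip_linear ip_norm_def)
    then show "(1 / ip_norm ip f) *\<^sub>R f \<in> S"
      using that M by (simp add: S_def subspace_scale)
    show "b ((1 / ip_norm ip f) *\<^sub>R f) ((1 / ip_norm ip f) *\<^sub>R f) = b f f / ip f f"
      using f p by (simp add: b.ip_linear ip_norm_def)
  qed
  have bdd: "bdd_above ((\<lambda>f. b f f) ` S)"
    using bounded M by (intro bdd_aboveI2[of _ _ C]) (force simp: S_def)
  obtain f0 where f0: "f0 \<in> M" "f0 \<noteq> 0" using M subspace_0 by blast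
  then have ne: "S \<noteq> {}" using normalise by blast
  have le: "b g g \<le> \<sigma> * ip g g" if g: "g \<in> M" for g
  proof (cases "g = 0")
    case True
    then show ?thesis by simp
  next
    case False
    then have "0 < ip g g" using g M ip_pos by blast
    moreover have "b g g / ip g g \<le> \<sigma>"
      unfolding \<sigma>_def normalise(2)[OF g False, symmetric]
      using bdd normalise(1)[OF g False] by (rule cSUP_upper2) simp
    ultimately show ?thesis by (simp add: field_simps)
  qed
  have pos: "\<sigma> > 0"
  proof -
    have "f0 \<in> H" using f0 M by blast
    then have "0 < b f0 f0" "0 < ip f0 f0" using f0 ip_pos b.ip_pos by auto
    with le[OF f0(1)] show ?thesis by (metis less_le_trans zero_less_mult_pos2)
  qed
  have "\<exists>f\<in>S. \<sigma> - 1 / (1 + real k) < b f f" for k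
  proof (rule ccontr)
    assume "\<not> ?thesis"
    then have "\<sigma> \<le> \<sigma> - 1 / (1 + real k)"
      by (subst \<sigma>_def, intro cSUP_least[OF ne]) (auto simp: not_less)
    then show False by (simp add: field_simps)
  qed
  then obtain F where F: "\<And>k. F k \<in> S" "\<And>k. \<sigma> - 1 / (1 + real k) < b (F k) (F k)" by metis
  have FM: "F k \<in> M" and FH: "F k \<in> H" and F1: "ip (F k) (F k) = 1" for k
    using F(1)[of k] M by (auto simp: S_def)
  obtain r :: "nat \<Rightarrow> nat" where r: "strict_mono r" and
    Cauchy: "\<forall>e>0. \<exists>N. \<forall>m\<ge>N. \<forall>n\<ge>N. b (F (r m) - F (r n)) (F (r m) - F (r n)) < e"
    using compact_form[of F, OF FH eq_refl[OF F1]] by blast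
  have conv: "(\<lambda>k. 1 / (1 + real k)) \<longlonglongrightarrow> 0"
    using LIMSEQ_inverse_real_of_nat by (simp add: inverse_eq_divide add.commute)
  have diff: "\<sigma> * ip (f - g) (f - g) \<le> b (f - g) (f - g) + 2 * (\<sigma> - b f f) + 2 * (\<sigma> - b g g)"
    if "f \<in> S" "g \<in> S" for f g
  proof -
    have fg: "f \<in> M" "g \<in> M" "f \<in> H" "g \<in> H" "ip f f = 1" "ip g g = 1"
      using that M by (auto simp: S_def)
    have "b (f + g) (f + g) \<le> \<sigma> * ip (f + g) (f + g)"
      using fg M by (intro le subspace_add)
    also have "\<dots> = \<sigma> * (4 - ip (f - g) (f - g))"
      using parallelogram[OF fg(3,4)] fg by simp
    finally show ?thesis
      using b.parallelogram[OF fg(3,4)] by (simp add: algebra_simps)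
  qed
  obtain f where f: "f \<in> H" "(\<lambda>n. ip_norm ip ((F \<circ> r) n - f)) \<longlonglongrightarrow> 0"
  proof (rule Cauchy_limit)
    show "(F \<circ> r) k \<in> H" for k using FH by simp
    fix e :: real assume e: "e > 0"
    then have "\<forall>\<^sub>F k in sequentially. 1 / (1 + real k) < \<sigma> * e / 8"
      using conv pos by (intro order_tendstoD) auto
    then obtain N1 where N1: "\<And>k. k \<ge> N1 \<Longrightarrow> 1 / (1 + real k) < \<sigma> * e / 8"
      by (auto simp: eventually_sequentially)
    obtain N2 where N2: "\<And>m n. m \<ge> N2 \<Longrightarrow> n \<ge> N2 \<Longrightarrow> b (F (r m) - F (r n)) (F (r m) - F (r n)) < \<sigma> * e / 2"
      using Cauchy[rule_format, of "\<sigma> * e / 2"] e pos by auto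
    have "ip ((F \<circ> r) k - (F \<circ> r) l) ((F \<circ> r) k - (F \<circ> r) l) < e" if kl: "k \<ge> max N1 N2" "l \<ge> max N1 N2" for k l
    proof -
      have near: "\<sigma> - b (F (r k)) (F (r k)) < \<sigma> * e / 8" if "k \<ge> max N1 N2" for k
        using F(2)[of "r k"] N1[of "r k"] seq_suble[OF r, of k] that by auto
      have "\<sigma> * ip (F (r k) - F (r l)) (F (r k) - F (r l)) < \<sigma> * e"
        using diff[OF F(1)[of "r k"] F(1)[of "r l"]] near[OF kl(1)] near[OF kl(2)] N2[of k l] kl by auto
      with pos show ?thesis by simp
    qed
    then show "\<exists>N. \<forall>k\<ge>N. \<forall>l\<ge>N. ip ((F \<circ> r) k - (F \<circ> r) l) ((F \<circ> r) k - (F \<circ> r) l) < e" by blast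
  qed auto
  have "(F \<circ> r) k \<in> H" for k using FH by simp
  note lims = tendsto_form[OF this f]
  have one: "ip f f = 1" using lims(2) F1 by (simp add: LIMSEQ_const_iff)
  have "(\<lambda>k. \<sigma> - 1 / (1 + real (r k))) \<longlonglongrightarrow> \<sigma> - 0"
    using LIMSEQ_subseq_LIMSEQ[OF conv r] by (intro tendsto_intros) (simp add: o_def)
  moreover have "\<sigma> - 1 / (1 + real (r k)) \<le> b ((F \<circ> r) k) ((F \<circ> r) k)" for k
    using F(2)[of "r k"] by simp
  ultimately have "\<sigma> - 0 \<le> b f f" using lims(1) by (intro LIMSEQ_le) auto
  moreover have fM: "f \<in> M" using closed[rule_format, of "F \<circ> r" f] FM f by simp
  ultimately have "b f f = \<sigma> * ip f f" using le[OF fM] one by simp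
  moreover have "f \<noteq> 0" using one by auto
  ultimately show ?thesis using that[of f \<sigma>] fM pos le by blast
qed

text \<open>
  The Euler equation of the maximiser only tests against \<open>M\<close>. Invariance places \<open>A f - \<sigma> f\<close> itself in
  \<open>M\<close>, so that it can be used as a test vector and must vanish.
\<close>

lemma eigenvector_exists:
  assumes M: "M \<subseteq> H" "subspace M" "M \<noteq> {0}"
    and closed: "\<forall>F f. (\<forall>k::nat. F k \<in> M) \<and> f \<in> H \<and> (\<lambda>k. ip_norm ip (F k - f)) \<longlonglongrightarrow> 0 \<longrightarrow> f \<in> M"
    and invariant: "\<And>f h. \<lbrakk>f \<in> M; h \<in> H; \<And>g. g \<in> H \<Longrightarrow> ip h g = b f g\<rbrakk> \<Longrightarrow> h \<in> M"
  obtains f \<sigma> where "f \<in> M" "f \<noteq> 0" "\<sigma> > 0" "f \<in> eigenspace \<sigma>"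
proof -
  obtain f \<sigma> where f: "f \<in> M" "f \<noteq> 0" "\<sigma> > 0" "b f f = \<sigma> * ip f f"
    and max: "\<And>g. g \<in> M \<Longrightarrow> b g g \<le> \<sigma> * ip g g"
    using maximizer_exists[OF M closed] by blast
  have fH: "f \<in> H" using f M by blast
  have stationary: "b f g = \<sigma> * ip f g" if g: "g \<in> M" for g
  proof -
    have gH: "g \<in> H" using g M by blast
    have "0 \<le> 2 * t * (\<sigma> * ip f g - b f g) + t\<^sup>2 * (\<sigma> * ip g g - b g g)" for t
    proof -
      have "b (f + t *\<^sub>R g) (f + t *\<^sub>R g) \<le> \<sigma> * ip (f + t *\<^sub>R g) (f + t *\<^sub>R g)"
        using M f g by (intro max subspace_add subspace_scale) auto
      then show ?thesis
        using fH gH f(4) ip_sym[of g f] b.ip_sym[of g f]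
        by (simp add: ip_linear b.ip_linear algebra_simps power2_eq_square)
    qed
    then have "\<sigma> * ip f g - b f g = 0" by (rule linear_coefficient_zero)
    then show ?thesis by simp
  qed
  obtain h where h: "h \<in> H" "\<And>g. g \<in> H \<Longrightarrow> ip h g = b f g"
    using form_representation[OF fH] by blast
  have hM: "h \<in> M" by (rule invariant[OF f(1) h])
  let ?d = "h - \<sigma> *\<^sub>R f"
  have "?d \<in> M" using hM f M by (intro subspace_diff subspace_scale)
  then have "ip ?d ?d = b f ?d - \<sigma> * ip f ?d"
    using h fH M by (subst ip_diff_left) (auto simp: ip_scale_left)
  also have "\<dots> = 0" using stationary[OF \<open>?d \<in> M\<close>] by simp
  finally have "h - \<sigma> *\<^sub>R f = 0" using h fH by (intro ip_eq_0D) auto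
  then have "b f g = \<sigma> * ip f g" if "g \<in> H" for g
    using h(2)[OF that] that fH by (simp add: ip_scale_left)
  then have "f \<in> eigenspace \<sigma>" using fH by (simp add: eigenspace_def)
  with f that show ?thesis by blast
qed

end

section \<open>Spectral expansion\<close>

text \<open>
  Finiteness of the levels \<open>{j. lam j = \<mu>}\<close> together with matching dimensions says that \<open>lam\<close> lists
  the positive eigenvalues with multiplicity. Completeness of the eigenvectors is not postulated but
  derived, in \<open>eigenfamily_total\<close>.
\<close>

locale compact_form_spectrum = compact_form_pair +
  fixes lam :: "nat \<Rightarrow> real"
  assumes decseq_lam: "decseq lam" and lam_pos: "\<And>j. 0 < lam j"
    and finite_level: "\<And>\<mu>. \<mu> > 0 \<Longrightarrow> finite {j. lam j = \<mu>}"
    and eigenspace_basis: "\<And>\<mu>. \<mu> > 0 \<Longrightarrow> \<exists>B. finite B \<and> independent B \<and> span B = eigenspace \<mu> \<and>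
      card B = card {j. lam j = \<mu>}"
begin

definition eigenfamily :: "(nat \<Rightarrow> 'a) \<Rightarrow> bool" where
  "eigenfamily \<phi> \<longleftrightarrow> b.orthonormal_on UNIV \<phi> \<and> (\<forall>j. \<phi> j \<in> eigenspace (lam j))"

lemma eigenspace_subset_H: "eigenspace \<mu> \<subseteq> H"
  by (auto simp: eigenspace_def)

lemma extend_in_eigenspace:
  assumes "\<mu> > 0" "I \<subseteq> {j. lam j = \<mu>}" "b.orthonormal_on I e" "e ` I \<subseteq> eigenspace \<mu>"
  obtains e' where "\<And>i. i \<in> I \<Longrightarrow> e' i = e i" "b.orthonormal_on {j. lam j = \<mu>} e'"
    "span (e' ` {j. lam j = \<mu>}) = eigenspace \<mu>"
proof -
  obtain B where B: "finite B" "independent B" "span B = eigenspace \<mu>" "card B = card {j. lam j = \<mu>}"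
    using eigenspace_basis[OF assms(1)] by blast
  then have "dim (eigenspace \<mu>) = card {j. lam j = \<mu>}"
    using dim_span_eq_card_independent[of B] by simp
  moreover have "eigenspace \<mu> \<subseteq> span B" using B by simp
  ultimately show ?thesis
    using b.orthonormal_extension[OF finite_level[OF assms(1)] assms(2-4) eigenspace_subset_H
        subspace_eigenspace B(1)] that by metis
qed

text \<open>
  Orthonormality has to be verified only within each level, since different eigenspaces are orthogonal.
\<close>

lemma eigenfamilyI:
  assumes "\<And>\<mu>. \<mu> > 0 \<Longrightarrow> b.orthonormal_on {j. lam j = \<mu>} \<phi>" "\<And>j. \<phi> j \<in> eigenspace (lam j)"
  shows "eigenfamily \<phi>"
proof -
  have "b (\<phi> i) (\<phi> j) = (if i = j then 1 else 0)" for i j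
  proof (cases "lam i = lam j")
    case True
    then show ?thesis using b.orthonormal_on_ip[OF assms(1)[OF lam_pos], of i j j] by simp
  next
    case False
    then show ?thesis using eigenspaces_orthogonal[OF assms(2) assms(2), of i j] by auto
  qed
  then show ?thesis
    using assms(2) eigenspace_subset_H unfolding eigenfamily_def b.orthonormal_on_def by blast
qed

lemma eigenfamily_exists: obtains \<phi> where "eigenfamily \<phi>"
proof -
  have "\<exists>e. b.orthonormal_on {j. lam j = \<mu>} e \<and> span (e ` {j. lam j = \<mu>}) = eigenspace \<mu>" if "\<mu> > 0" for \<mu>
    by (rule extend_in_eigenspace[OF that empty_subsetI, of "\<lambda>_. 0"]) (auto simp: b.orthonormal_on_def)
  then obtain E where E: "\<And>\<mu>. \<mu> > 0 \<Longrightarrow> b.orthonormal_on {j. lam j = \<mu>} (E \<mu>)"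
    "\<And>\<mu>. \<mu> > 0 \<Longrightarrow> span (E \<mu> ` {j. lam j = \<mu>}) = eigenspace \<mu>" by metis
  have "eigenfamily (\<lambda>j. E (lam j) j)"
  proof (rule eigenfamilyI)
    show "b.orthonormal_on {j. lam j = \<mu>} (\<lambda>j. E (lam j) j)" if "\<mu> > 0" for \<mu>
      using E(1)[OF that] by (simp add: b.orthonormal_on_def)
    show "E (lam j) j \<in> eigenspace (lam j)" for j
      unfolding E(2)[OF lam_pos, symmetric] by (intro span_base) simp
  qed
  then show ?thesis by (rule that)
qed

context
  fixes \<phi> assumes \<phi>: "eigenfamily \<phi>"
begin

lemma eigenfamily_mem: "\<phi> j \<in> eigenspace (lam j)" "\<phi> j \<in> H"
  using \<phi> eigenspace_subset_H by (auto simp: eigenfamily_def)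

lemma eigenfamily_orthonormal: "b.orthonormal_on J \<phi>"
  using \<phi> b.orthonormal_on_subset unfolding eigenfamily_def by blast

text \<open>
  Any eigenfamily exhausts each eigenspace, because it provides as many orthonormal vectors as the
  dimension.
\<close>

lemma eigenfamily_span_level:
  assumes "\<mu> > 0"
  shows "span (\<phi> ` {j. lam j = \<mu>}) = eigenspace \<mu>"
proof -
  have "\<phi> ` {j. lam j = \<mu>} \<subseteq> eigenspace \<mu>" using eigenfamily_mem by auto
  then obtain e where "\<And>j. j \<in> {j. lam j = \<mu>} \<Longrightarrow> e j = \<phi> j"
    "b.orthonormal_on {j. lam j = \<mu>} e" "span (e ` {j. lam j = \<mu>}) = eigenspace \<mu>"
    by (rule extend_in_eigenspace[OF assms order_refl eigenfamily_orthonormal]) (rule that)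
  then show ?thesis by (metis (no_types, lifting) image_cong)
qed

text \<open>
  Otherwise the orthogonal complement of the family is a nonzero closed invariant subspace and contains
  an eigenvector. Its eigenspace is spanned by members of the family, to which it is orthogonal.
\<close>

lemma eigenfamily_total:
  assumes f: "f \<in> H" and orth: "\<And>j. ip f (\<phi> j) = 0"
  shows "f = 0"
proof (rule ccontr)
  assume "f \<noteq> 0"
  define M where "M = {f \<in> H. \<forall>j. ip f (\<phi> j) = 0}"
  have ne: "M \<noteq> {0}" using f orth \<open>f \<noteq> 0\<close> by (auto simp: M_def)
  have sub: "subspace M"
    using eigenfamily_mem by (auto simp: M_def subspace_def ip_linear)
  have MH: "M \<subseteq> H" by (auto simp: M_def)
  have closed: "\<forall>F f. (\<forall>k::nat. F k \<in> M) \<and> f \<in> H \<and> (\<lambda>k. ip_norm ip (F k - f)) \<longlonglongrightarrow> 0 \<longrightarrow> f \<in> M"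
  proof (intro allI impI)
    fix F :: "nat \<Rightarrow> 'a" and f
    assume *: "(\<forall>k. F k \<in> M) \<and> f \<in> H \<and> (\<lambda>k. ip_norm ip (F k - f)) \<longlonglongrightarrow> 0"
    have "ip f (\<phi> j) = 0" for j
    proof -
      have "(\<lambda>k. ip (F k) (\<phi> j)) \<longlonglongrightarrow> ip f (\<phi> j)"
        using * MH eigenfamily_mem by (intro tendsto_ip_left) auto
      moreover have "ip (F k) (\<phi> j) = 0" for k using * by (simp add: M_def)
      ultimately show ?thesis by (simp add: LIMSEQ_const_iff)
    qed
    with * show "f \<in> M" by (simp add: M_def)
  qed
  have invariant: "h \<in> M" if *: "f \<in> M" "h \<in> H" "\<And>g. g \<in> H \<Longrightarrow> ip h g = b f g" for f h
  proof -
    have "ip h (\<phi> j) = 0" for j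
    proof -
      have "f \<in> H" "ip f (\<phi> j) = 0" using *(1) by (auto simp: M_def)
      then show ?thesis
        using *(3)[OF eigenfamily_mem(2)[of j]] eigenspaceD'[OF eigenfamily_mem(1)[of j]] by simp
    qed
    with * show ?thesis by (simp add: M_def)
  qed
  obtain g \<sigma> where g: "g \<in> M" "g \<noteq> 0" "\<sigma> > 0" "g \<in> eigenspace \<sigma>"
    by (rule eigenvector_exists[OF MH sub ne closed]) (use invariant that in blast)+
  then have gH: "g \<in> H" by (simp add: M_def)
  have "eigenspace \<sigma> \<subseteq> {v \<in> H. b g v = 0}"
    unfolding eigenfamily_span_level[OF g(3), symmetric]
  proof (intro span_minimal)
    show "subspace {v \<in> H. b g v = 0}" using gH by (auto simp: subspace_def b.ip_linear)
    show "\<phi> ` {j. lam j = \<sigma>} \<subseteq> {v \<in> H. b g v = 0}"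
      using g eigenspaceD(2)[OF g(4)] eigenfamily_mem by (auto simp: M_def)
  qed
  with g(4) have "b g g = 0" by blast
  with gH g(2) show False using b.ip_eq_0D by blast
qed

text \<open>
  An eigenvector that is normalised for \<open>b\<close> has squared \<open>ip\<close> norm \<open>1 / lam j\<close>, so these multiples are
  normalised for \<open>ip\<close>.
\<close>

definition \<psi> :: "nat \<Rightarrow> 'a" where
  "\<psi> j = sqrt (lam j) *\<^sub>R \<phi> j"

lemma \<psi>_mem: "\<psi> j \<in> H" "\<psi> j \<in> eigenspace (lam j)"
  using eigenfamily_mem subspace_eigenspace by (auto simp: \<psi>_def subspace_scale)

lemma \<psi>_orthonormal: "orthonormal_on J \<psi>"
proof -
  have "ip (\<psi> i) (\<psi> j) = (if i = j then 1 else 0)" for i j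
  proof -
    have "lam i * ip (\<phi> i) (\<phi> j) = (if i = j then 1 else 0)"
      using eigenspaceD(2)[OF eigenfamily_mem(1) eigenfamily_mem(2), of i j]
        b.orthonormal_on_ip[OF eigenfamily_orthonormal[of UNIV], of i j] by simp
    then have "ip (\<phi> i) (\<phi> j) = (if i = j then 1 / lam i else 0)"
      using lam_pos[of i] by (auto simp: field_simps split: if_splits)
    then show ?thesis
      using eigenfamily_mem lam_pos[of i] by (auto simp: \<psi>_def ip_scale_left ip_scale_right)
  qed
  then show ?thesis using \<psi>_mem by (simp add: orthonormal_on_def)
qed

lemma span_\<psi>: "span (\<psi> ` J) = span (\<phi> ` J)"
  unfolding \<psi>_def using lam_pos by (intro span_scaled_family) (metis less_irrefl real_sqrt_eq_zero_cancel_iff)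

lemma form_\<psi>: "f \<in> H \<Longrightarrow> b f (\<psi> j) = lam j * ip f (\<psi> j)"
  using \<psi>_mem eigenspaceD' by blast

lemma \<psi>_total: "\<lbrakk>f \<in> H; \<And>j. ip f (\<psi> j) = 0\<rbrakk> \<Longrightarrow> f = 0"
proof (rule eigenfamily_total)
  fix j assume "f \<in> H" "\<And>j. ip f (\<psi> j) = 0"
  then have "sqrt (lam j) * ip f (\<phi> j) = 0"
    using eigenfamily_mem by (metis \<psi>_def ip_scale_right)
  then show "ip f (\<phi> j) = 0" using lam_pos[of j] by simp
qed

text \<open>
  Since \<open>ip f (\<psi> j) *\<^sub>R \<psi> j = b f (\<phi> j) *\<^sub>R \<phi> j\<close>, the expansions of \<open>f\<close> with respect to the two inner
  products have the same partial sums, and one remainder serves both identities.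
\<close>

lemma \<psi>_Parseval:
  assumes f: "f \<in> H"
  shows "(\<lambda>j. (ip f (\<psi> j))\<^sup>2) sums ip f f" "(\<lambda>j. lam j * (ip f (\<psi> j))\<^sup>2) sums b f f"
proof -
  define R where "R N = f - expansion {..<N} \<psi> f" for N
  have R: "R N \<in> H" for N using f expansion_mem[OF \<psi>_orthonormal] by (simp add: R_def)
  have "(\<lambda>N. ip_norm ip (R N)) \<longlonglongrightarrow> 0"
    unfolding R_def by (rule complete_orthonormal_expansion[OF \<psi>_orthonormal \<psi>_total f])
  then have "(\<lambda>N. (ip_norm ip (R N))\<^sup>2) \<longlonglongrightarrow> 0\<^sup>2" by (rule tendsto_power)
  then have sq: "(\<lambda>N. ip (R N) (R N)) \<longlonglongrightarrow> 0" using R by (simp add: ip_norm_square)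
  have bsq: "(\<lambda>N. b (R N) (R N)) \<longlonglongrightarrow> 0"
  proof (rule tendsto_sandwich[OF _ _ tendsto_const])
    show "(\<lambda>N. C * ip (R N) (R N)) \<longlonglongrightarrow> 0"
      using tendsto_mult[OF tendsto_const sq, of C] by simp
  qed (use R b.ip_nonneg bounded in auto)
  have "(\<lambda>N. ip f f - ip (R N) (R N)) \<longlonglongrightarrow> ip f f - 0" by (intro tendsto_intros sq)
  moreover have "ip f f - ip (R N) (R N) = (\<Sum>j<N. (ip f (\<psi> j))\<^sup>2)" for N
    unfolding R_def using f by (simp add: ip_residual[OF \<psi>_orthonormal])
  ultimately show "(\<lambda>j. (ip f (\<psi> j))\<^sup>2) sums ip f f" by (simp add: sums_def)
  have coeff: "ip f (\<psi> j) *\<^sub>R \<psi> j = b f (\<phi> j) *\<^sub>R \<phi> j"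
    "(b f (\<phi> j))\<^sup>2 = lam j * (ip f (\<psi> j))\<^sup>2" for j
    using f eigenfamily_mem[of j] eigenspaceD'[OF eigenfamily_mem(1)[of j] f] lam_pos[of j]
    by (simp_all add: \<psi>_def ip_scale_right power_mult_distrib power2_eq_square)
  have "expansion {..<N} \<psi> f = b.expansion {..<N} \<phi> f" for N
    by (simp add: expansion_def b.expansion_def coeff)
  then have "b f f - b (R N) (R N) = (\<Sum>j<N. lam j * (ip f (\<psi> j))\<^sup>2)" for N
    unfolding R_def using f by (simp add: b.ip_residual[OF eigenfamily_orthonormal] coeff)
  moreover have "(\<lambda>N. b f f - b (R N) (R N)) \<longlonglongrightarrow> b f f - 0" by (intro tendsto_intros bsq)
  ultimately show "(\<lambda>j. lam j * (ip f (\<psi> j))\<^sup>2) sums b f f" by (simp add: sums_def)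
qed

text \<open>
  If \<open>f\<close> has no component outside the level \<open>\<mu>\<close>, then \<open>A f\<close> and \<open>\<mu> f\<close> have the same coefficients.
\<close>

lemma eigenspaceI:
  assumes f: "f \<in> H" and orth: "\<And>j. lam j \<noteq> \<mu> \<Longrightarrow> ip f (\<psi> j) = 0"
  shows "f \<in> eigenspace \<mu>"
proof -
  obtain h where h: "h \<in> H" "\<And>g. g \<in> H \<Longrightarrow> ip h g = b f g"
    using form_representation[OF f] by blast
  have "h - \<mu> *\<^sub>R f = 0"
  proof (rule \<psi>_total)
    show "h - \<mu> *\<^sub>R f \<in> H" using f h by simp
    show "ip (h - \<mu> *\<^sub>R f) (\<psi> j) = 0" for j
      using f h \<psi>_mem[of j] form_\<psi>[OF f, of j] orth[of j] by (cases "lam j = \<mu>") (simp_all add: ip_linear)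
  qed
  then have "b f g = \<mu> * ip f g" if "g \<in> H" for g
    using h(2)[OF that] that f by (simp add: ip_scale_left)
  with f show ?thesis by (simp add: eigenspace_def)
qed

section \<open>Ky Fan's maximum principle\<close>

definition weight :: "'i set \<Rightarrow> ('i \<Rightarrow> 'a) \<Rightarrow> nat \<Rightarrow> real" where
  "weight I v j = (\<Sum>i\<in>I. (ip (v i) (\<psi> j))\<^sup>2)"

text \<open>
  For an orthonormal family \<open>v\<^sub>0, \<dots>, v\<^sub>n\<^sub>-\<^sub>1\<close> the weight \<open>w\<^sub>j\<close> is the squared length of the projection of
  \<open>\<psi> j\<close> to its span, hence lies in \<open>[0, 1]\<close>, and the weights add up to \<open>n\<close>. The \<open>j\<close>-th term below equals
  \<open>(lam j - \<mu>) (1 - w\<^sub>j)\<close> for \<open>j < n\<close> and \<open>(\<mu> - lam j) w\<^sub>j\<close> otherwise. Subtracting \<open>\<mu>\<close>, the smallest of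
  the first \<open>n\<close> eigenvalues, makes all terms nonnegative.
\<close>

lemma Ky_Fan_sums:
  assumes v: "orthonormal_on {..<n} v" and n: "n > 0"
  defines "\<mu> \<equiv> lam (n - 1)"
  shows "(\<lambda>j. (\<mu> - lam j) * weight {..<n} v j - (if j < n then \<mu> - lam j else 0))
           sums ((\<Sum>j<n. lam j) - (\<Sum>i<n. b (v i) (v i)))"
    and "\<And>j. 0 \<le> (\<mu> - lam j) * weight {..<n} v j - (if j < n then \<mu> - lam j else 0)"
proof -
  have vH: "v i \<in> H" if "i < n" for i using v that by (simp add: orthonormal_on_mem)
  have "(\<lambda>j. \<Sum>i<n. \<mu> * (ip (v i) (\<psi> j))\<^sup>2 - lam j * (ip (v i) (\<psi> j))\<^sup>2)
          sums (\<Sum>i<n. \<mu> * ip (v i) (v i) - b (v i) (v i))"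
    using vH by (intro sums_sum sums_diff sums_mult \<psi>_Parseval) auto
  moreover have "(\<Sum>i<n. \<mu> * ip (v i) (v i)) = (\<Sum>i<n. \<mu>)"
    using orthonormal_on_ip[OF v] by (intro sum.cong) auto
  ultimately have *: "(\<lambda>j. (\<mu> - lam j) * weight {..<n} v j) sums ((\<Sum>i<n. \<mu>) - (\<Sum>i<n. b (v i) (v i)))"
    by (simp add: weight_def sum_subtractf sum_distrib_left left_diff_distrib)
  have "(\<lambda>j. if j \<in> {..<n} then \<mu> - lam j else 0) sums (\<Sum>j<n. \<mu> - lam j)"
    by (intro sums_If_finite_set) simp
  then have "(\<lambda>j. if j < n then \<mu> - lam j else 0) sums (\<Sum>j<n. \<mu> - lam j)" by simp
  from sums_diff[OF * this]
  show "(\<lambda>j. (\<mu> - lam j) * weight {..<n} v j - (if j < n then \<mu> - lam j else 0))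
           sums ((\<Sum>j<n. lam j) - (\<Sum>i<n. b (v i) (v i)))"
    by (simp add: sum_subtractf)
  fix j
  have w0: "0 \<le> weight {..<n} v j" by (simp add: weight_def sum_nonneg)
  have "weight {..<n} v j = (\<Sum>i<n. (ip (\<psi> j) (v i))\<^sup>2)"
    unfolding weight_def using vH \<psi>_mem ip_sym by (intro sum.cong) auto
  then have w1: "weight {..<n} v j \<le> 1"
    using Bessel[OF v _ \<psi>_mem(1), of j] orthonormal_on_ip[OF \<psi>_orthonormal[of UNIV], of j j] by simp
  show "0 \<le> (\<mu> - lam j) * weight {..<n} v j - (if j < n then \<mu> - lam j else 0)"
  proof (cases "j < n")
    case True
    then have "\<mu> \<le> lam j" unfolding \<mu>_def using decseq_lam by (auto simp: decseq_def)
    then have "0 \<le> (lam j - \<mu>) * (1 - weight {..<n} v j)" using w1 by simp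
    with True show ?thesis by (simp add: algebra_simps)
  next
    case False
    then have "lam j \<le> \<mu>" unfolding \<mu>_def using decseq_lam by (auto simp: decseq_def)
    with False w0 show ?thesis by simp
  qed
qed

end

lemma Ky_Fan_le:
  assumes "orthonormal_on {..<n} v"
  shows "(\<Sum>i<n. b (v i) (v i)) \<le> (\<Sum>j<n. lam j)"
proof (cases "n = 0")
  case False
  obtain \<phi> where \<phi>: "eigenfamily \<phi>" by (rule eigenfamily_exists)
  show ?thesis
    using sums_le[OF _ sums_zero Ky_Fan_sums(1)[OF \<phi> assms]] Ky_Fan_sums(2)[OF \<phi> assms] False by simp
qed simp

lemma eigenfamily_form_sum:
  assumes "eigenfamily \<phi>"
  shows "orthonormal_on {..<n} (\<psi> \<phi>)" "span (\<psi> \<phi> ` {..<n}) = span (\<phi> ` {..<n})"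
    "(\<Sum>i<n. b (\<psi> \<phi> i) (\<psi> \<phi> i)) = (\<Sum>j<n. lam j)"
  using assms \<psi>_orthonormal span_\<psi> form_\<psi> \<psi>_mem orthonormal_on_ip[OF \<psi>_orthonormal[of \<phi> UNIV]]
  by (auto intro!: sum.cong)

text \<open>
  Equality forces every term of \<open>Ky_Fan_sums\<close> to vanish: \<open>\<psi> j\<close> lies in the span \<open>V\<close> when \<open>lam j > \<mu>\<close> and
  is orthogonal to it when \<open>lam j < \<mu>\<close>. Completing the \<open>\<psi> j\<close> of the first kind to an orthonormal basis
  of \<open>V\<close> therefore adds only vectors of the eigenspace of \<open>\<mu>\<close>. These are completed once more, inside that
  eigenspace, and replace the corresponding members of an arbitrary eigenfamily.
\<close>

lemma Ky_Fan_equality: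
  assumes v: "orthonormal_on {..<n} v" and n: "n > 0"
    and eq: "(\<Sum>i<n. b (v i) (v i)) = (\<Sum>j<n. lam j)"
  obtains \<phi> where "eigenfamily \<phi>" "span (v ` {..<n}) = span (\<phi> ` {..<n})"
proof -
  obtain \<phi> where \<phi>: "eigenfamily \<phi>" by (rule eigenfamily_exists)
  define \<mu> where "\<mu> = lam (n - 1)"
  have \<mu>: "\<mu> > 0" using lam_pos by (simp add: \<mu>_def)
  let ?w = "weight \<phi> {..<n} v" and ?V = "span (v ` {..<n})"
  let ?I = "{j. lam j > \<mu>}"
  have vH: "v i \<in> H" if "i < n" for i using v that by (simp add: orthonormal_on_mem)
  have VH: "?V \<subseteq> H" using v by (rule span_orthonormal_subset_H)
  have "(\<lambda>j. (\<mu> - lam j) * ?w j - (if j < n then \<mu> - lam j else 0)) sums 0"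
    using Ky_Fan_sums(1)[OF \<phi> v n] unfolding eq \<mu>_def by (simp only: diff_self)
  then have zero: "(\<mu> - lam j) * ?w j - (if j < n then \<mu> - lam j else 0) = 0" for j
    using sums_iff suminf_eq_zero_iff[of "\<lambda>j. (\<mu> - lam j) * ?w j - (if j < n then \<mu> - lam j else 0)"]
      Ky_Fan_sums(2)[OF \<phi> v n] unfolding \<mu>_def by blast
  have le: "\<mu> \<le> lam j" if "j < n" for j
    unfolding \<mu>_def using that decseq_lam by (auto simp: decseq_def)
  have ge: "lam j \<le> \<mu>" if "\<not> j < n" for j
    unfolding \<mu>_def using that decseq_lam by (auto simp: decseq_def)
  have I: "?I \<subseteq> {..<n}" using ge by force
  have top: "\<psi> \<phi> j \<in> ?V" if "j \<in> ?I" for j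
  proof (rule in_span_if_Bessel_equality[OF v _ \<psi>_mem(1)[OF \<phi>]])
    have "?w j = 1" using zero[of j] that I by auto
    moreover have "?w j = (\<Sum>i<n. (ip (\<psi> \<phi> j) (v i))\<^sup>2)"
      unfolding weight_def[OF \<phi>] using vH \<psi>_mem[OF \<phi>] ip_sym by (intro sum.cong) auto
    ultimately show "(\<Sum>i<n. (ip (\<psi> \<phi> j) (v i))\<^sup>2) = ip (\<psi> \<phi> j) (\<psi> \<phi> j)"
      using orthonormal_on_ip[OF \<psi>_orthonormal[OF \<phi>, of UNIV], of j j] by simp
  qed simp
  have bottom: "ip u (\<psi> \<phi> j) = 0" if "u \<in> ?V" "lam j < \<mu>" for u j
  proof -
    have "?w j = 0" using zero[of j] that le[of j] by (auto split: if_splits)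
    then have "ip (v i) (\<psi> \<phi> j) = 0" if "i < n" for i
      using that by (auto simp: weight_def[OF \<phi>] sum_nonneg_eq_0_iff)
    then have "?V \<subseteq> {u \<in> H. ip u (\<psi> \<phi> j) = 0}"
      using vH \<psi>_mem[OF \<phi>] by (intro span_minimal) (auto simp: subspace_def ip_linear)
    with that show ?thesis by blast
  qed
  have "dim ?V = card {..<n}"
    using orthonormal_on_independent[OF v] by (simp add: dim_eq_card_independent card_image)
  then obtain e where e: "\<And>i. i \<in> ?I \<Longrightarrow> e i = \<psi> \<phi> i" "orthonormal_on {..<n} e" "span (e ` {..<n}) = ?V"
    using orthonormal_extension[OF finite_lessThan I \<psi>_orthonormal[OF \<phi>] _ VH subspace_span _ order_refl] top
    by (metis (no_types, lifting) finite_imageI finite_lessThan image_subsetI)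
  let ?J = "{j. j < n \<and> lam j = \<mu>}"
  have eV: "e j \<in> ?V" "e j \<in> H" if "j < n" for j
    using that span_base[of "e j" "e ` {..<n}"] VH e(3) by auto
  have level: "e j \<in> eigenspace \<mu>" if j: "j \<in> ?J" for j
  proof (rule eigenspaceI[OF \<phi>])
    show "e j \<in> H" using eV j by simp
    fix k assume "lam k \<noteq> \<mu>"
    then consider "lam k < \<mu>" | "k \<in> ?I" by fastforce
    then show "ip (e j) (\<psi> \<phi> k) = 0"
    proof cases
      case 1
      then show ?thesis using bottom eV j by blast
    next
      case 2
      then have "ip (e j) (e k) = 0" using orthonormal_on_ip[OF e(2), of j k] j I by auto
      then show ?thesis using e(1)[OF 2] by simp
    qed
  qed
  define u where "u j = (1 / sqrt \<mu>) *\<^sub>R e j" for j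
  have uE: "u j \<in> eigenspace \<mu>" if "j \<in> ?J" for j
    using level[OF that] by (simp add: u_def subspace_scale subspace_eigenspace)
  have "b (u i) (u j) = (if i = j then 1 else 0)" if "i \<in> ?J" "j \<in> ?J" for i j
    using that eigenspaceD(2)[OF level[OF that(1)] eV(2)] orthonormal_on_ip[OF e(2), of i j] eV \<mu>
    by (simp add: u_def b.ip_scale_left b.ip_scale_right)
  then have "b.orthonormal_on ?J u"
    using uE eigenspaceD(1) unfolding b.orthonormal_on_def by blast
  then obtain u' where u': "\<And>i. i \<in> ?J \<Longrightarrow> u' i = u i" "b.orthonormal_on {j. lam j = \<mu>} u'"
    "span (u' ` {j. lam j = \<mu>}) = eigenspace \<mu>"
    using extend_in_eigenspace[OF \<mu>, of ?J u] uE by auto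
  define \<phi>' where "\<phi>' j = (if lam j = \<mu> then u' j else \<phi> j)" for j
  have "eigenfamily \<phi>'"
  proof (rule eigenfamilyI)
    show "b.orthonormal_on {j. lam j = \<nu>} \<phi>'" for \<nu>
      using u'(2) eigenfamily_orthonormal[OF \<phi>, of "{j. lam j = \<nu>}"]
      by (cases "\<nu> = \<mu>") (simp_all add: \<phi>'_def b.orthonormal_on_def)
    show "\<phi>' j \<in> eigenspace (lam j)" for j
      using u'(3) span_base[of "u' j" "u' ` {j. lam j = \<mu>}"] eigenfamily_mem(1)[OF \<phi>] by (auto simp: \<phi>'_def)
  qed
  moreover have "e j = sqrt (lam j) *\<^sub>R \<phi>' j" if "j < n" for j
  proof (cases "lam j = \<mu>")
    case True
    then show ?thesis using u'(1)[of j] that \<mu> by (simp add: \<phi>'_def u_def)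
  next
    case False
    then have "j \<in> ?I" using le[OF that] by simp
    then show ?thesis using e(1) False by (simp add: \<phi>'_def \<psi>_def[OF \<phi>])
  qed
  then have "e ` {..<n} = (\<lambda>j. sqrt (lam j) *\<^sub>R \<phi>' j) ` {..<n}" by (intro image_cong) auto
  then have "?V = span (\<phi>' ` {..<n})"
    using e(3) span_scaled_family[of "{..<n}" "\<lambda>j. sqrt (lam j)" \<phi>'] lam_pos
    by (metis less_irrefl real_sqrt_eq_zero_cancel_iff)
  ultimately show ?thesis by (rule that)
qed

end

section \<open>Continuous functions on a compact set of full support\<close>

lemma sum_fun_apply: "(\<Sum>i\<in>I. F i) x = (\<Sum>i\<in>I. F i x)"
  by (induction I rule: infinite_finite_induct) auto

lemma scaleR_fun_apply: "(c *\<^sub>R f) x = c *\<^sub>R f x"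
  by (simp add: scaleR_fun_def)

lemma integrable_continuous_compact:
  fixes g :: "real ^ 'd \<Rightarrow> real"
  assumes "compact \<Omega>" "continuous_on \<Omega> g"
  shows "integrable (lebesgue_on \<Omega>) g"
proof -
  have "integrable lborel (\<lambda>x. indicator \<Omega> x *\<^sub>R g x)"
    using assms by (rule borel_integrable_compact)
  then have "integrable lebesgue (\<lambda>x. indicator \<Omega> x *\<^sub>R g x)"
    using integrable_completion[OF borel_measurable_integrable] by blast
  moreover have "\<Omega> \<inter> space lebesgue \<in> sets lebesgue"
    using assms(1) by (auto intro: lmeasurable_compact fmeasurableD)
  ultimately show ?thesis by (simp add: integrable_restrict_space)
qed

text \<open>
  The set where \<open>f\<close> does not vanish is relatively open, so it would have positive measure if it were
  nonempty.
\<close>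

lemma AE_zero_continuous:
  assumes "compact \<Omega>" "full_support \<Omega>" "continuous_on \<Omega> f"
    and ae: "AE x in lebesgue_on \<Omega>. f x = (0::real)" and x: "x \<in> \<Omega>"
  shows "f x = 0"
proof (rule ccontr)
  assume nz: "f x \<noteq> 0"
  have \<Omega>: "\<Omega> \<in> sets lebesgue" using assms(1) by (auto intro: lmeasurable_compact fmeasurableD)
  have "open (- {0::real})" by (simp add: open_Compl)
  then obtain U where U: "open U" "U \<inter> \<Omega> = f -` (- {0}) \<inter> \<Omega>"
    using assms(3) unfolding continuous_on_open_invariant by metis
  have "x \<in> U" using U(2) nz x by blast
  then have pos: "emeasure lebesgue (\<Omega> \<inter> U) > 0"
    using assms(2) U(1) x unfolding full_support_def by blast
  have "AE x in lebesgue. x \<in> \<Omega> \<longrightarrow> f x = 0"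
    using ae \<Omega> by (simp add: AE_restrict_space_iff)
  then have "AE x in lebesgue. x \<notin> \<Omega> \<inter> U"
    by eventually_elim (use U(2) in blast)
  moreover have "\<Omega> \<inter> U \<in> sets lebesgue" using \<Omega> U(1) by auto
  ultimately have "emeasure lebesgue (\<Omega> \<inter> U) = 0"
    by (subst AE_iff_measurable[symmetric, where P = "\<lambda>x. x \<notin> \<Omega> \<inter> U"]) auto
  with pos show False by simp
qed

section \<open>The native space and its two inner products\<close>

locale continuous_native_space =
  fixes \<Omega> :: "(real ^ 'd) set" and K H ip
  assumes compact_\<Omega>: "compact \<Omega>" and full: "full_support \<Omega>"
    and K_cont: "continuous_on (\<Omega> \<times> \<Omega>) (\<lambda>(x, y). K x y)"
    and native: "native_space \<Omega> K H ip"
begin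

sublocale hilbert_subspace H ip
proof -
  have "hilbert_function_space \<Omega> H ip" using native by (simp add: native_space_def)
  then show "hilbert_subspace H ip"
    unfolding hilbert_function_space_def
    by unfold_locales auto
qed

abbreviation ksec :: "real ^ 'd \<Rightarrow> real ^ 'd \<Rightarrow> real" where
  "ksec \<equiv> kernel_section \<Omega> K"

abbreviation \<Lambda> :: "(real ^ 'd) measure" where
  "\<Lambda> \<equiv> lebesgue_on \<Omega>"

lemma ksec_mem: "x \<in> \<Omega> \<Longrightarrow> ksec x \<in> H"
  and reproducing: "x \<in> \<Omega> \<Longrightarrow> f \<in> H \<Longrightarrow> ip f (ksec x) = f x"
  using native by (auto simp: native_space_def)

lemma ip_ksec: "x \<in> \<Omega> \<Longrightarrow> y \<in> \<Omega> \<Longrightarrow> ip (ksec x) (ksec y) = K x y"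
  using reproducing[of y "ksec x"] ksec_mem[of x] by (simp add: kernel_section_def)

lemma vanishes_outside: "f \<in> H \<Longrightarrow> x \<notin> \<Omega> \<Longrightarrow> f x = 0"
  using native by (auto simp: native_space_def hilbert_function_space_def)

lemma ext_on_\<Omega>: "\<lbrakk>f \<in> H; g \<in> H; \<And>x. x \<in> \<Omega> \<Longrightarrow> f x = g x\<rbrakk> \<Longrightarrow> f = g"
  using vanishes_outside by (metis ext)

lemma K_cont_left: "x \<in> \<Omega> \<Longrightarrow> continuous_on \<Omega> (K x)"
  using continuous_on_compose2[OF K_cont, of \<Omega> "\<lambda>y. (x, y)"]
  by (simp add: continuous_on_Pair image_subset_iff)

lemma K_cont_diagonal: "continuous_on \<Omega> (\<lambda>x. K x x)"
  using continuous_on_compose2[OF K_cont, of \<Omega> "\<lambda>x. (x, x)"]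
  by (simp add: continuous_on_Pair image_subset_iff)

definition Kmax :: real where
  "Kmax = (SUP x\<in>\<Omega>. \<bar>K x x\<bar>)"

lemma K_le_Kmax: "x \<in> \<Omega> \<Longrightarrow> K x x \<le> Kmax"
proof -
  assume x: "x \<in> \<Omega>"
  have "compact ((\<lambda>x. \<bar>K x x\<bar>) ` \<Omega>)"
    using compact_\<Omega> K_cont_diagonal by (intro compact_continuous_image continuous_intros)
  then have "bdd_above ((\<lambda>x. \<bar>K x x\<bar>) ` \<Omega>)"
    by (intro bounded_imp_bdd_above compact_imp_bounded)
  then have "\<bar>K x x\<bar> \<le> Kmax" unfolding Kmax_def using x by (intro cSUP_upper)
  then show ?thesis by simp
qed

lemma pointwise_bound:
  assumes "f \<in> H" "x \<in> \<Omega>"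
  shows "\<bar>f x\<bar> \<le> ip_norm ip f * sqrt Kmax"
proof -
  have "\<bar>f x\<bar> \<le> ip_norm ip f * sqrt (K x x)"
    using Cauchy_Schwarz[OF assms(1) ksec_mem[OF assms(2)]] reproducing[OF assms(2,1)]
      ip_ksec[OF assms(2,2)] by (simp add: ip_norm_def)
  also have "\<dots> \<le> ip_norm ip f * sqrt Kmax"
    using assms K_le_Kmax ip_nonneg by (intro mult_left_mono) (auto simp: ip_norm_def)
  finally show ?thesis .
qed

text \<open>
  Equicontinuity of the balls of the native space: \<open>f(x) - f(y)\<close> is the inner product of \<open>f\<close> with
  \<open>K\<^sub>x - K\<^sub>y\<close>, whose squared norm \<open>K(x,x) - 2 K(x,y) + K(y,y)\<close> is continuous in \<open>y\<close> and vanishes at \<open>x\<close>.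
\<close>

lemma modulus_of_continuity:
  assumes "x \<in> \<Omega>" "e > 0" "B > 0"
  shows "\<exists>d>0. \<forall>f\<in>H. \<forall>y\<in>\<Omega>. ip_norm ip f \<le> B \<longrightarrow> norm (x - y) < d \<longrightarrow> \<bar>f x - f y\<bar> < e"
proof -
  let ?D = "\<lambda>y. K x x - 2 * K x y + K y y"
  have D: "ip (ksec x - ksec y) (ksec x - ksec y) = ?D y" if "y \<in> \<Omega>" for y
    using that assms(1) ksec_mem ip_ksec ip_sym[of "ksec x" "ksec y"] by (simp add: ip_linear)
  have "continuous_on \<Omega> ?D"
    using K_cont_left[OF assms(1)] K_cont_diagonal by (intro continuous_intros)
  moreover have "?D x = 0" by simp
  ultimately obtain d where d: "d > 0" "\<forall>y\<in>\<Omega>. dist y x < d \<longrightarrow> dist (?D y) 0 < (e / B)\<^sup>2"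
    using assms unfolding continuous_on_iff by (metis zero_less_divide_iff zero_less_power)
  have "\<bar>f x - f y\<bar> < e" if f: "f \<in> H" "ip_norm ip f \<le> B" and y: "y \<in> \<Omega>" "norm (x - y) < d" for f y
  proof -
    have "?D y < (e / B)\<^sup>2" using d(2) y by (auto simp: dist_norm norm_minus_commute)
    then have "ip_norm ip (ksec x - ksec y) < e / B"
      unfolding ip_norm_def D[OF y(1)] using assms by (intro real_less_lsqrt) auto
    moreover have "\<bar>f x - f y\<bar> \<le> ip_norm ip f * ip_norm ip (ksec x - ksec y)"
      using Cauchy_Schwarz[OF f(1), of "ksec x - ksec y"] f y assms(1) ksec_mem
      by (simp add: ip_linear reproducing)
    moreover have "ip_norm ip f * ip_norm ip (ksec x - ksec y) \<le> B * ip_norm ip (ksec x - ksec y)"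
      using f y assms ksec_mem ip_nonneg by (intro mult_right_mono) (auto simp: ip_norm_def)
    ultimately show ?thesis using assms by (simp add: field_simps)
  qed
  with d(1) show ?thesis by blast
qed

lemma continuous_on_H: "f \<in> H \<Longrightarrow> continuous_on \<Omega> f"
proof -
  assume f: "f \<in> H"
  show ?thesis
    unfolding continuous_on_iff
  proof (intro ballI allI impI)
    fix x and e :: real assume "x \<in> \<Omega>" "e > 0"
    moreover have "ip_norm ip f + 1 > 0" using f ip_nonneg by (simp add: ip_norm_def add_nonneg_pos)
    ultimately obtain d where "d > 0"
      "\<forall>f'\<in>H. \<forall>y\<in>\<Omega>. ip_norm ip f' \<le> ip_norm ip f + 1 \<longrightarrow> norm (x - y) < d \<longrightarrow> \<bar>f' x - f' y\<bar> < e"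
      using modulus_of_continuity by blast
    then show "\<exists>d>0. \<forall>x'\<in>\<Omega>. dist x' x < d \<longrightarrow> dist (f x') (f x) < e"
      using f by (intro exI[of _ d]) (auto simp: dist_real_def dist_norm norm_minus_commute abs_minus_commute)
  qed
qed

lemma integrable_H:
  "f \<in> H \<Longrightarrow> integrable \<Lambda> f"
  "f \<in> H \<Longrightarrow> g \<in> H \<Longrightarrow> integrable \<Lambda> (\<lambda>x. f x * g x)"
  "f \<in> H \<Longrightarrow> integrable \<Lambda> (\<lambda>x. (f x)\<^sup>2)"
  by (intro integrable_continuous_compact compact_\<Omega> continuous_intros continuous_on_H; assumption)+

lemma integrable_const: "integrable \<Lambda> (\<lambda>x. c :: real)"
  by (intro integrable_continuous_compact compact_\<Omega> continuous_intros)

lemma integrable_K: "integrable \<Lambda> (\<lambda>x. K x x)"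
  by (intro integrable_continuous_compact compact_\<Omega> K_cont_diagonal)

definition l2 :: "(real ^ 'd \<Rightarrow> real) \<Rightarrow> (real ^ 'd \<Rightarrow> real) \<Rightarrow> real" where
  "l2 f g = (LINT x|\<Lambda>. f x * g x)"

lemma AE_eq_imp_eq:
  assumes "f \<in> H" "g \<in> H" "AE x in \<Lambda>. f x = g x"
  shows "f = g"
proof (rule ext_on_\<Omega>[OF assms(1,2)])
  fix x assume x: "x \<in> \<Omega>"
  have "continuous_on \<Omega> (\<lambda>x. f x - g x)" using assms continuous_on_H by (intro continuous_intros)
  moreover have "AE x in \<Lambda>. f x - g x = 0" using assms(3) by simp
  ultimately show "f x = g x" using AE_zero_continuous[OF compact_\<Omega> full _ _ x] by fastforce
qed

lemma l2_inner_product: "inner_product_subspace H l2"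
proof
  show "subspace H" by (rule subspace_H)
  fix f g h :: "real ^ 'd \<Rightarrow> real" and c :: real
  show "l2 f g = l2 g f" if "f \<in> H" "g \<in> H" by (simp add: l2_def mult.commute)
  show "l2 (f + g) h = l2 f h + l2 g h" if "f \<in> H" "g \<in> H" "h \<in> H"
    using that integrable_H by (simp add: l2_def distrib_right)
  show "l2 (c *\<^sub>R f) g = c * l2 f g" if "f \<in> H" "g \<in> H"
    by (simp add: l2_def scaleR_fun_apply mult.assoc)
  show "0 \<le> l2 f f" if "f \<in> H" by (simp add: l2_def)
  show "f = 0" if "f \<in> H" "l2 f f = 0"
  proof (rule AE_eq_imp_eq)
    show "f \<in> H" "0 \<in> H" using that by auto
    have "AE x in \<Lambda>. f x * f x = 0"
      using that integral_nonneg_eq_0_iff_AE[of \<Lambda> "\<lambda>x. f x * f x"] integrable_H by (simp add: l2_def)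
    then show "AE x in \<Lambda>. f x = 0 x" by simp
  qed
qed

definition vol :: real where
  "vol = (LINT x|\<Lambda>. 1)"

lemma l2_le_sup:
  assumes "f \<in> H" "\<And>x. x \<in> \<Omega> \<Longrightarrow> \<bar>f x\<bar> \<le> c"
  shows "l2 f f \<le> c\<^sup>2 * vol"
proof -
  have "l2 f f \<le> (LINT x|\<Lambda>. c\<^sup>2 * 1)"
    unfolding l2_def
  proof (rule integral_mono)
    fix x assume "x \<in> space \<Lambda>"
    then have "\<bar>f x\<bar>\<^sup>2 \<le> c\<^sup>2" using assms(2)[of x] by (intro power_mono) auto
    then show "f x * f x \<le> c\<^sup>2 * 1" by (simp add: power2_eq_square)
  qed (use assms integrable_H integrable_const in auto)
  then show ?thesis by (simp add: vol_def mult.commute)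
qed

lemma vol_nonneg: "0 \<le> vol"
  by (simp add: vol_def)

text \<open>
  Compactness of the embedding into \<open>L\<^sub>2(\<Omega>)\<close>: by the Arzela-Ascoli theorem the unit ball is relatively
  compact even for uniform convergence.
\<close>

sublocale compact_form_pair H ip l2 "Kmax * vol"
proof -
  interpret b: inner_product_subspace H l2 by (rule l2_inner_product)
  show "compact_form_pair H ip l2 (Kmax * vol)"
  proof
    fix f assume f: "f \<in> H"
    show "l2 f f \<le> Kmax * vol * ip f f"
    proof (cases "\<Omega> = {}")
      case True
      then have "f = 0" using f vanishes_outside by auto
      then show ?thesis by simp
    next
      case False
      then obtain x where x: "x \<in> \<Omega>" by blast
      then have "0 \<le> Kmax" using K_le_Kmax[OF x] ip_nonneg[OF ksec_mem[OF x]] ip_ksec[OF x x] by simp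
      moreover have "l2 f f \<le> (ip_norm ip f * sqrt Kmax)\<^sup>2 * vol"
        using f by (intro l2_le_sup pointwise_bound)
      ultimately show ?thesis using f by (simp add: power_mult_distrib ip_norm_square algebra_simps)
    qed
  next
    fix F :: "nat \<Rightarrow> real ^ 'd \<Rightarrow> real"
    assume F: "\<And>k. F k \<in> H" "\<And>k. ip (F k) (F k) \<le> 1"
    have F1: "ip_norm ip (F k) \<le> 1" for k using F by (simp add: ip_norm_def)
    obtain g r where r: "strict_mono (r :: nat \<Rightarrow> nat)"
      and unif: "\<And>e. 0 < e \<Longrightarrow> \<exists>N. \<forall>n x. n \<ge> N \<and> x \<in> \<Omega> \<longrightarrow> norm (F (r n) x - g x) < e"
    proof (rule Arzela_Ascoli[OF compact_\<Omega>, of F "sqrt \<bar>Kmax\<bar>"])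
      show "norm (F n x) \<le> sqrt \<bar>Kmax\<bar>" if "x \<in> \<Omega>" for n x
      proof -
        have "\<bar>F n x\<bar> \<le> ip_norm ip (F n) * sqrt Kmax" using that F by (intro pointwise_bound)
        also have "\<dots> \<le> ip_norm ip (F n) * sqrt \<bar>Kmax\<bar>"
          using F b.ip_nonneg ip_nonneg by (intro mult_left_mono) (auto simp: ip_norm_def)
        also have "\<dots> \<le> 1 * sqrt \<bar>Kmax\<bar>" using F1 by (intro mult_right_mono) auto
        finally show ?thesis by simp
      qed
      show "\<exists>d>0. \<forall>n y. y \<in> \<Omega> \<and> norm (x - y) < d \<longrightarrow> norm (F n x - F n y) < e" if "x \<in> \<Omega>" "0 < e" for x e
        using modulus_of_continuity[OF that, of 1] F F1 by (metis real_norm_def zero_less_one)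
    qed blast
    have "\<exists>N. \<forall>m\<ge>N. \<forall>n\<ge>N. l2 (F (r m) - F (r n)) (F (r m) - F (r n)) < e" if e: "e > 0" for e
    proof -
      define d where "d = sqrt (e / (vol + 1))"
      have d: "d > 0" using e vol_nonneg by (simp add: d_def)
      have "d\<^sup>2 = e / (vol + 1)" using e vol_nonneg by (simp add: d_def)
      then have "d\<^sup>2 * vol + d\<^sup>2 = e" using e vol_nonneg by (simp add: field_simps)
      then have dv: "d\<^sup>2 * vol < e" using d by (smt (verit) zero_less_power)
      obtain N where N: "\<forall>n x. n \<ge> N \<and> x \<in> \<Omega> \<longrightarrow> norm (F (r n) x - g x) < d / 2"
        using unif[of "d / 2"] d by auto
      have "l2 (F (r m) - F (r n)) (F (r m) - F (r n)) < e" if "m \<ge> N" "n \<ge> N" for m n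
      proof -
        have "l2 (F (r m) - F (r n)) (F (r m) - F (r n)) \<le> d\<^sup>2 * vol"
        proof (rule l2_le_sup)
          show "F (r m) - F (r n) \<in> H" using F by simp
          fix x assume x: "x \<in> \<Omega>"
          have "\<bar>F (r m) x - g x\<bar> < d / 2" "\<bar>F (r n) x - g x\<bar> < d / 2"
            using N that x by auto
          then show "\<bar>(F (r m) - F (r n)) x\<bar> \<le> d" by (simp add: abs_if split: if_splits)
        qed
        with dv show ?thesis by simp
      qed
      then show ?thesis by blast
    qed
    with r show "\<exists>r::nat\<Rightarrow>nat. strict_mono r \<and> (\<forall>e>0. \<exists>N. \<forall>m\<ge>N. \<forall>n\<ge>N. l2 (F (r m) - F (r n)) (F (r m) - F (r n)) < e)"
      by blast
  qed
qed

end

section \<open>Eigenfunctions of the integral operator\<close>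

context continuous_native_space
begin

lemma integrable_L2_mult:
  assumes f: "f \<in> L2_functions \<Omega>" and g: "g \<in> H"
  shows "integrable \<Lambda> (\<lambda>x. f x * g x)"
proof -
  obtain B where B: "\<And>x. x \<in> \<Omega> \<Longrightarrow> \<bar>g x\<bar> \<le> B" using pointwise_bound[OF g] by blast
  have fm: "f \<in> borel_measurable \<Lambda>" and f2: "integrable \<Lambda> (\<lambda>x. (f x)\<^sup>2)"
    using f by (auto simp: L2_functions_def)
  show ?thesis
  proof (rule Bochner_Integration.integrable_bound)
    show "integrable \<Lambda> (\<lambda>x. \<bar>B\<bar> * ((f x)\<^sup>2 + 1))"
      using f2 integrable_const by (intro integrable_mult_right Bochner_Integration.integrable_add)
    show "(\<lambda>x. f x * g x) \<in> borel_measurable \<Lambda>"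
      using fm integrable_H(1)[OF g] by (intro borel_measurable_times) auto
    show "AE x in \<Lambda>. norm (f x * g x) \<le> norm (\<bar>B\<bar> * ((f x)\<^sup>2 + 1))"
    proof (rule AE_I2)
      fix x assume "x \<in> space \<Lambda>"
      then have "\<bar>g x\<bar> \<le> \<bar>B\<bar>" using B[of x] by simp
      moreover have "\<bar>f x\<bar> \<le> (f x)\<^sup>2 + 1"
        using sum_squares_bound[of "\<bar>f x\<bar>" 1] by simp
      ultimately have "\<bar>f x\<bar> * \<bar>g x\<bar> \<le> ((f x)\<^sup>2 + 1) * \<bar>B\<bar>" by (intro mult_mono) auto
      then show "norm (f x * g x) \<le> norm (\<bar>B\<bar> * ((f x)\<^sup>2 + 1))" by (simp add: abs_mult mult.commute)
    qed
  qed
qed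

lemma integrable_L2:
  assumes f: "f \<in> L2_functions \<Omega>"
  shows "integrable \<Lambda> f"
proof (rule Bochner_Integration.integrable_bound)
  show "integrable \<Lambda> (\<lambda>x. (f x)\<^sup>2 + 1)"
    using f integrable_const by (intro Bochner_Integration.integrable_add) (auto simp: L2_functions_def)
  show "f \<in> borel_measurable \<Lambda>" using f by (simp add: L2_functions_def)
  have "\<bar>f x\<bar> \<le> (f x)\<^sup>2 + 1" for x
    using sum_squares_bound[of "\<bar>f x\<bar>" 1] by simp
  then show "AE x in \<Lambda>. norm (f x) \<le> norm ((f x)\<^sup>2 + 1)" by (intro AE_I2) (simp add: add_nonneg_pos)
qed

text \<open>
  The operator \<open>T\<close> maps \<open>L\<^sub>2\<close> into the native space: \<open>Tf\<close> represents the functional \<open>g \<mapsto> \<integral> f g\<close>, as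
  testing with the kernel sections shows.
\<close>

lemma integral_operator_representation:
  assumes f: "f \<in> L2_functions \<Omega>"
  obtains h where "h \<in> H" "\<And>g. g \<in> H \<Longrightarrow> ip h g = (LINT x|\<Lambda>. f x * g x)"
    "\<And>x. x \<in> \<Omega> \<Longrightarrow> h x = integral_operator \<Omega> K f x"
proof -
  obtain h where h: "h \<in> H" "\<And>g. g \<in> H \<Longrightarrow> ip h g = (LINT x|\<Lambda>. f x * g x)"
  proof (rule Riesz_representation)
    show "(LINT x|\<Lambda>. f x * (g + g') x) = (LINT x|\<Lambda>. f x * g x) + (LINT x|\<Lambda>. f x * g' x)"
      if "g \<in> H" "g' \<in> H" for g g'
      using that integrable_L2_mult[OF f] by (simp add: distrib_left)
    show "(LINT x|\<Lambda>. f x * (c *\<^sub>R g) x) = c * (LINT x|\<Lambda>. f x * g x)" if "g \<in> H" for c g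
      by (simp add: scaleR_fun_apply mult.left_commute)
    show "\<bar>LINT x|\<Lambda>. f x * g x\<bar> \<le> ((LINT x|\<Lambda>. \<bar>f x\<bar>) * sqrt Kmax) * ip_norm ip g" if g: "g \<in> H" for g
    proof -
      have "\<bar>LINT x|\<Lambda>. f x * g x\<bar> \<le> (LINT x|\<Lambda>. \<bar>f x * g x\<bar>)" by (rule integral_abs_bound)
      also have "\<dots> \<le> (LINT x|\<Lambda>. \<bar>f x\<bar> * (ip_norm ip g * sqrt Kmax))"
      proof (rule integral_mono)
        show "integrable \<Lambda> (\<lambda>x. \<bar>f x * g x\<bar>)" using integrable_L2_mult[OF f g] by (rule integrable_abs)
        show "integrable \<Lambda> (\<lambda>x. \<bar>f x\<bar> * (ip_norm ip g * sqrt Kmax))"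
          using integrable_L2[OF f] by (intro integrable_mult_left integrable_abs)
        fix x assume "x \<in> space \<Lambda>"
        then show "\<bar>f x * g x\<bar> \<le> \<bar>f x\<bar> * (ip_norm ip g * sqrt Kmax)"
          unfolding abs_mult using pointwise_bound[OF g, of x] by (intro mult_left_mono) auto
      qed
      finally show ?thesis by (simp add: mult_ac)
    qed
  qed blast
  have "h x = integral_operator \<Omega> K f x" if x: "x \<in> \<Omega>" for x
  proof -
    have "h x = (LINT y|\<Lambda>. f y * ksec x y)"
      using h(2)[OF ksec_mem[OF x]] reproducing[OF x h(1)] by simp
    also have "\<dots> = integral_operator \<Omega> K f x"
      unfolding integral_operator_def
      by (intro Bochner_Integration.integral_cong) (auto simp: kernel_section_def)
    finally show ?thesis .
  qed
  with h that show ?thesis by blast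
qed

lemma H_subset_L2: "H \<subseteq> L2_functions \<Omega>"
  using integrable_H by (auto simp: L2_functions_def)

lemma eigenspace_subset_L2_eigenspace: "eigenspace \<mu> \<subseteq> L2_eigenspace \<Omega> K \<mu>"
proof
  fix f assume f: "f \<in> eigenspace \<mu>"
  then have fH: "f \<in> H" by (rule eigenspaceD)
  have "integral_operator \<Omega> K f x = \<mu> * f x" if x: "x \<in> \<Omega>" for x
  proof -
    have "integral_operator \<Omega> K f x = l2 f (ksec x)"
      unfolding integral_operator_def l2_def
      by (intro Bochner_Integration.integral_cong) (auto simp: kernel_section_def)
    also have "\<dots> = \<mu> * ip f (ksec x)" using f ksec_mem[OF x] by (rule eigenspaceD)
    finally show ?thesis using reproducing[OF x fH] by simp
  qed
  then show "f \<in> L2_eigenspace \<Omega> K \<mu>"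
    using fH H_subset_L2 by (auto simp: L2_eigenspace_def intro!: AE_I2)
qed

text \<open>
  The representative is \<open>\<mu>\<^sup>-\<^sup>1 T f\<close>, which lies in the native space and equals \<open>f\<close> almost everywhere.
\<close>

lemma L2_eigenspace_representative:
  assumes f: "f \<in> L2_eigenspace \<Omega> K \<mu>" and \<mu>: "\<mu> > 0"
  obtains u where "u \<in> eigenspace \<mu>" "AE x in \<Lambda>. f x = u x"
proof -
  have fL: "f \<in> L2_functions \<Omega>" and ae: "AE x in \<Lambda>. integral_operator \<Omega> K f x = \<mu> * f x"
    using f by (auto simp: L2_eigenspace_def)
  obtain h where h: "h \<in> H" "\<And>g. g \<in> H \<Longrightarrow> ip h g = (LINT x|\<Lambda>. f x * g x)"
    "\<And>x. x \<in> \<Omega> \<Longrightarrow> h x = integral_operator \<Omega> K f x"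
    using integral_operator_representation[OF fL] by blast
  define u where "u = (1 / \<mu>) *\<^sub>R h"
  have uH: "u \<in> H" using h(1) by (simp add: u_def)
  have fu: "AE x in \<Lambda>. f x = u x"
    using ae AE_space
    by eventually_elim (use h(3) \<mu> in \<open>simp add: u_def scaleR_fun_apply field_simps\<close>)
  have "l2 u g = \<mu> * ip u g" if g: "g \<in> H" for g
  proof -
    have "l2 u g = (LINT x|\<Lambda>. f x * g x)"
      unfolding l2_def
    proof (rule integral_cong_AE)
      show "(\<lambda>x. u x * g x) \<in> borel_measurable \<Lambda>" using integrable_H(2)[OF uH g] by auto
      show "(\<lambda>x. f x * g x) \<in> borel_measurable \<Lambda>" using integrable_L2_mult[OF fL g] by auto
      show "AE x in \<Lambda>. u x * g x = f x * g x" using fu by eventually_elim simp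
    qed
    then show ?thesis using h(1) h(2)[OF g] g \<mu> by (simp add: u_def ip_scale_left)
  qed
  with uH have "u \<in> eigenspace \<mu>" by (simp add: eigenspace_def)
  with fu that show ?thesis by blast
qed

lemma L2_eigenspace_in_H:
  assumes "f \<in> H" "f \<in> L2_eigenspace \<Omega> K \<mu>" "\<mu> > 0"
  shows "f \<in> eigenspace \<mu>"
proof -
  obtain u where u: "u \<in> eigenspace \<mu>" "AE x in \<Lambda>. f x = u x"
    using L2_eigenspace_representative assms by blast
  then have "f = u" using assms(1) eigenspaceD(1) by (intro AE_eq_imp_eq)
  with u show ?thesis by simp
qed

text \<open>
  Members of the native space that agree almost everywhere are equal. Replacing a basis modulo null sets
  by its representatives therefore gives a basis in the ordinary sense, of the same size.
\<close>

lemma eigenspace_basis_of_L2_dim: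
  assumes \<mu>: "\<mu> > 0" and dim: "has_L2_dim \<Omega> (L2_eigenspace \<Omega> K \<mu>) m"
  shows "\<exists>B. finite B \<and> independent B \<and> span B = eigenspace \<mu> \<and> card B = m"
proof -
  obtain b where b: "\<And>i. i < m \<Longrightarrow> b i \<in> L2_eigenspace \<Omega> K \<mu>"
    and indep: "\<And>c i. (AE x in \<Lambda>. (\<Sum>i<m. c i * b i x) = 0) \<Longrightarrow> i < m \<Longrightarrow> c i = 0"
    and spans: "\<And>f. f \<in> L2_eigenspace \<Omega> K \<mu> \<Longrightarrow> \<exists>c. AE x in \<Lambda>. f x = (\<Sum>i<m. c i * b i x)"
    using dim unfolding has_L2_dim_def by blast
  have "\<exists>u. u \<in> eigenspace \<mu> \<and> (AE x in \<Lambda>. b i x = u x)" if "i < m" for i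
    using L2_eigenspace_representative[OF b[OF that] \<mu>] by blast
  then obtain u where u: "\<And>i. i < m \<Longrightarrow> u i \<in> eigenspace \<mu>" "\<And>i. i < m \<Longrightarrow> AE x in \<Lambda>. b i x = u i x"
    by metis
  have uH: "u i \<in> H" if "i < m" for i using u(1)[OF that] eigenspaceD by blast
  have "AE x in \<Lambda>. \<forall>i\<in>{..<m}. b i x = u i x"
    using u(2) by (intro AE_finite_allI) auto
  then have ae: "AE x in \<Lambda>. (\<Sum>i<m. c i * b i x) = (\<Sum>i<m. c i *\<^sub>R u i) x" for c
    by eventually_elim (simp add: sum_fun_apply scaleR_fun_apply)
  have zero: "c i = 0" if "(\<Sum>i<m. c i *\<^sub>R u i) = 0" "i < m" for c i
    using ae[of c] that by (intro indep[of c i]) (auto elim: eventually_mono)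
  have inj: "inj_on u {..<m}"
  proof (rule inj_onI, rule ccontr)
    fix i j assume *: "i \<in> {..<m}" "j \<in> {..<m}" "u i = u j" "i \<noteq> j"
    let ?c = "\<lambda>k. if k = i then 1 else if k = j then -1 else (0::real)"
    have "(\<Sum>k<m. ?c k *\<^sub>R u k) = (\<Sum>k<m. (if k = i then u i else 0) - (if k = j then u j else 0))"
      using * by (intro sum.cong) auto
    also have "\<dots> = 0" using * by (simp add: sum_subtractf)
    finally have "?c i = 0" using * by (intro zero[of ?c]) auto
    then show False by simp
  qed
  have "independent (u ` {..<m})"
  proof (rule independent_if_scalars_zero)
    fix c w assume "(\<Sum>x\<in>u ` {..<m}. c x *\<^sub>R x) = 0" "w \<in> u ` {..<m}"
    moreover from this obtain i where "i < m" "w = u i" by blast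
    ultimately show "c w = 0" using zero[of "c \<circ> u" i] by (simp add: sum.reindex[OF inj])
  qed simp
  moreover have "span (u ` {..<m}) = eigenspace \<mu>"
  proof
    show "span (u ` {..<m}) \<subseteq> eigenspace \<mu>"
      using u(1) subspace_eigenspace by (intro span_minimal) auto
    show "eigenspace \<mu> \<subseteq> span (u ` {..<m})"
    proof
      fix f assume f: "f \<in> eigenspace \<mu>"
      then obtain c where c: "AE x in \<Lambda>. f x = (\<Sum>i<m. c i * b i x)"
        using spans eigenspace_subset_L2_eigenspace by blast
      have "f = (\<Sum>i<m. c i *\<^sub>R u i)"
      proof (rule AE_eq_imp_eq)
        show "f \<in> H" using f by (rule eigenspaceD)
        show "(\<Sum>i<m. c i *\<^sub>R u i) \<in> H" using uH by (intro sum_mem_H mem_H(4)) simp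
        show "AE x in \<Lambda>. f x = (\<Sum>i<m. c i *\<^sub>R u i) x" using c ae[of c] by eventually_elim simp
      qed
      also have "\<dots> \<in> span (u ` {..<m})" by (intro span_sum span_scale span_base) auto
      finally show "f \<in> span (u ` {..<m})" .
    qed
  qed
  moreover have "card (u ` {..<m}) = m" using inj by (simp add: card_image)
  ultimately show ?thesis by blast
qed

section \<open>The power function\<close>

lemma orthogonal_projector_eq:
  assumes v: "orthonormal_on J v" "finite J" and f: "f \<in> H"
  shows "orthogonal_projector ip (span (v ` J)) f = expansion J v f"
  unfolding orthogonal_projector_def
proof (rule the_equality)
  show "expansion J v f \<in> span (v ` J) \<and> (\<forall>w\<in>span (v ` J). ip (f - expansion J v f) w = 0)"
    using v f residual_orthogonal expansion_in_span by blast
  fix g assume g: "g \<in> span (v ` J) \<and> (\<forall>w\<in>span (v ` J). ip (f - g) w = 0)"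
  let ?d = "g - expansion J v f"
  have d: "?d \<in> span (v ` J)" using g expansion_in_span by (intro span_diff) auto
  have H: "g \<in> H" "expansion J v f \<in> H" "?d \<in> H"
    using g d span_orthonormal_subset_H[OF v(1)] expansion_mem[OF v(1)] by auto
  have "ip ?d ?d = ip (f - expansion J v f) ?d - ip (f - g) ?d"
    using H f by (simp add: ip_diff_left)
  also have "\<dots> = 0" using g d residual_orthogonal[OF v f d] by simp
  finally have "?d = 0" using H by (intro ip_eq_0D)
  then show "g = expansion J v f" by simp
qed

text \<open>
  With \<open>r = K\<^sub>x - \<Pi> K\<^sub>x\<close> the error at \<open>x\<close> is \<open>ip f r\<close>. Its supremum over the unit ball is the norm of
  \<open>r\<close>, attained at the normalised \<open>r\<close>.
\<close>

lemma power_function_eq: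
  assumes v: "orthonormal_on J v" "finite J" and x: "x \<in> \<Omega>"
  shows "power_function H ip (span (v ` J)) x = sqrt (K x x - (\<Sum>j\<in>J. (v j x)\<^sup>2))"
    "(\<Sum>j\<in>J. (v j x)\<^sup>2) \<le> K x x"
proof -
  have vH: "v j \<in> H" if "j \<in> J" for j using v that by (simp add: orthonormal_on_mem)
  define r where "r = ksec x - expansion J v (ksec x)"
  have rH: "r \<in> H" using ksec_mem[OF x] expansion_mem[OF v(1)] by (simp add: r_def)
  have coeff: "ip (ksec x) (v j) = v j x" if "j \<in> J" for j
    using reproducing[OF x vH[OF that]] ip_sym[OF vH[OF that] ksec_mem[OF x]] by simp
  have rr: "ip r r = K x x - (\<Sum>j\<in>J. (v j x)\<^sup>2)"
    unfolding r_def ip_residual[OF v ksec_mem[OF x]] ip_ksec[OF x x]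
    by (simp add: coeff)
  show "(\<Sum>j\<in>J. (v j x)\<^sup>2) \<le> K x x" using ip_nonneg[OF rH] rr by simp
  have error: "f x - orthogonal_projector ip (span (v ` J)) f x = ip f r" if f: "f \<in> H" for f
  proof -
    have "ip f (expansion J v (ksec x)) = (\<Sum>j\<in>J. v j x * ip f (v j))"
      unfolding expansion_def using f vH by (simp add: ip_sum_right ip_scale_right coeff)
    moreover have "expansion J v f x = (\<Sum>j\<in>J. ip f (v j) * v j x)"
      by (simp add: expansion_def sum_fun_apply scaleR_fun_apply)
    ultimately show ?thesis
      using f ksec_mem[OF x] expansion_mem[OF v(1)] reproducing[OF x f]
      by (simp add: orthogonal_projector_eq[OF v f] r_def ip_diff_right mult.commute)
  qed
  have "power_function H ip (span (v ` J)) x = ip_norm ip r"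
    unfolding power_function_def
  proof (rule cSup_eq_maximum)
    \<comment> \<open>for \<open>r = 0\<close> the quotient is \<open>0\<close>, and the vector \<open>0\<close> attains the supremum \<open>0\<close>\<close>
    have "ip ((1 / ip_norm ip r) *\<^sub>R r) r = ip_norm ip r"
      using rH ip_nonneg[OF rH] by (simp add: ip_scale_left ip_norm_def real_div_sqrt)
    then have "ip_norm ip r = \<bar>ip ((1 / ip_norm ip r) *\<^sub>R r) r\<bar>"
      using ip_nonneg[OF rH] by (simp add: ip_norm_def)
    moreover have "ip_norm ip ((1 / ip_norm ip r) *\<^sub>R r) \<le> 1"
      using rH ip_nonneg[OF rH] by (simp add: ip_norm_def ip_scale_left ip_scale_right)
    ultimately show "ip_norm ip r \<in> (\<lambda>f. \<bar>f x - orthogonal_projector ip (span (v ` J)) f x\<bar>) ` {f \<in> H. ip_norm ip f \<le> 1}"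
      using rH by (intro image_eqI[of _ _ "(1 / ip_norm ip r) *\<^sub>R r"]) (simp_all add: error)
  next
    fix y assume "y \<in> (\<lambda>f. \<bar>f x - orthogonal_projector ip (span (v ` J)) f x\<bar>) ` {f \<in> H. ip_norm ip f \<le> 1}"
    then obtain f where f: "f \<in> H" "ip_norm ip f \<le> 1" "y = \<bar>ip f r\<bar>" by (auto simp: error)
    have "y \<le> ip_norm ip f * ip_norm ip r" unfolding f(3) using f(1) rH by (rule Cauchy_Schwarz)
    also have "\<dots> \<le> 1 * ip_norm ip r"
      using f(2) ip_nonneg[OF rH] by (intro mult_right_mono) (auto simp: ip_norm_def)
    finally show "y \<le> ip_norm ip r" by simp
  qed
  then show "power_function H ip (span (v ` J)) x = sqrt (K x x - (\<Sum>j\<in>J. (v j x)\<^sup>2))"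
    by (simp add: ip_norm_def rr)
qed

definition trace :: real where
  "trace = (LINT x|\<Lambda>. K x x)"

lemma L2_norm_power_function:
  assumes v: "orthonormal_on J v" "finite J"
  shows "L2_norm_on \<Omega> (power_function H ip (span (v ` J))) = sqrt (trace - (\<Sum>j\<in>J. l2 (v j) (v j)))"
proof -
  have vH: "v j \<in> H" if "j \<in> J" for j using v that by (simp add: orthonormal_on_mem)
  have "(LINT x|\<Lambda>. (power_function H ip (span (v ` J)) x)\<^sup>2) = (LINT x|\<Lambda>. K x x - (\<Sum>j\<in>J. (v j x)\<^sup>2))"
    using power_function_eq[OF v] by (intro Bochner_Integration.integral_cong) auto
  also have "\<dots> = trace - (\<Sum>j\<in>J. l2 (v j) (v j))"
    unfolding trace_def l2_def using vH integrable_H(3) integrable_K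
    by (subst Bochner_Integration.integral_diff)
      (auto simp: Bochner_Integration.integral_sum power2_eq_square[symmetric])
  finally show ?thesis by (simp add: L2_norm_on_def)
qed

lemma orthonormal_basis_of_subspace:
  assumes "V \<in> subspaces_of_dim H n" "n > 0"
  obtains v where "orthonormal_on {..<n} v" "span (v ` {..<n}) = V"
proof -
  have V: "subspace V" "V \<subseteq> H" "dim V = n" using assms by (auto simp: subspaces_of_dim_def)
  obtain B where B: "B \<subseteq> V" "independent B" "V \<subseteq> span B" "card B = dim V"
    by (rule basis_exists)
  then have "finite B" using V assms(2) card_ge_0_finite by metis
  obtain v where "\<And>i. i \<in> {} \<Longrightarrow> v i = (\<lambda>_. 0) i" "orthonormal_on {..<n} v" "span (v ` {..<n}) = V"
    by (rule orthonormal_extension[of "{..<n}" "{}" "\<lambda>_. 0" V B])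
      (use V B \<open>finite B\<close> that in \<open>auto simp: orthonormal_on_def\<close>)
  with that show ?thesis by blast
qed

lemma span_orthonormal_in_subspaces:
  assumes "orthonormal_on {..<n} v"
  shows "span (v ` {..<n}) \<in> subspaces_of_dim H n"
  using span_orthonormal_subset_H[OF assms] orthonormal_on_independent[OF assms]
  by (simp add: subspaces_of_dim_def dim_eq_card_independent card_image)

end

section \<open>Optimal subspaces\<close>

locale native_space_spectrum = continuous_native_space +
  fixes lam :: "nat \<Rightarrow> real"
  assumes eigenvalues: "positive_eigenvalues \<Omega> K lam"
begin

sublocale compact_form_spectrum H ip l2 "Kmax * vol" lam
  using eigenvalues eigenspace_basis_of_L2_dim
  by unfold_locales (auto simp: positive_eigenvalues_def)

lemma orthonormal_eigenfunctions_iff: "orthonormal_eigenfunctions \<Omega> K H lam \<phi> \<longleftrightarrow> eigenfamily \<phi>"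
proof
  assume "orthonormal_eigenfunctions \<Omega> K H lam \<phi>"
  then show "eigenfamily \<phi>"
    using L2_eigenspace_in_H lam_pos
    by (auto simp: orthonormal_eigenfunctions_def eigenfamily_def b.orthonormal_on_def l2_def)
next
  assume "eigenfamily \<phi>"
  then show "orthonormal_eigenfunctions \<Omega> K H lam \<phi>"
    using subsetD[OF eigenspace_subset_L2_eigenspace]
    by (auto simp: orthonormal_eigenfunctions_def eigenfamily_def b.orthonormal_on_def l2_def)
qed

text \<open>
  Mercer's trace formula. Parseval for the kernel section at \<open>x\<close> reads \<open>K(x,x) = \<Sum>\<^sub>j \<psi>\<^sub>j(x)\<^sup>2\<close>; the partial
  sums are dominated by \<open>K(x,x)\<close>, and \<open>\<psi>\<^sub>j\<close> has squared \<open>L\<^sub>2\<close> norm \<open>lam j\<close>.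
\<close>

lemma lam_sums_trace: "lam sums trace"
proof -
  obtain \<phi> where \<phi>: "eigenfamily \<phi>" by (rule eigenfamily_exists)
  let ?p = "\<psi> \<phi>"
  have pH: "?p j \<in> H" for j by (rule \<psi>_mem[OF \<phi>])
  have pointwise: "(\<lambda>j. (?p j x)\<^sup>2) sums K x x" if x: "x \<in> \<Omega>" for x
  proof -
    have "ip (ksec x) (?p j) = ?p j x" for j
      using reproducing[OF x pH] ip_sym[OF pH ksec_mem[OF x]] by simp
    then show ?thesis using \<psi>_Parseval(1)[OF \<phi> ksec_mem[OF x]] by (simp add: ip_ksec[OF x x])
  qed
  have "(\<lambda>N. LINT x|\<Lambda>. (\<Sum>j<N. (?p j x)\<^sup>2)) \<longlonglongrightarrow> (LINT x|\<Lambda>. K x x)"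
  proof (rule integral_dominated_convergence[where w = "\<lambda>x. K x x"])
    show "(\<lambda>x. K x x) \<in> borel_measurable \<Lambda>" "integrable \<Lambda> (\<lambda>x. K x x)"
      using integrable_K by auto
    show "(\<lambda>x. \<Sum>j<N. (?p j x)\<^sup>2) \<in> borel_measurable \<Lambda>" for N
      using integrable_H(3)[OF pH] by (intro borel_measurable_sum) auto
    show "AE x in \<Lambda>. (\<lambda>N. \<Sum>j<N. (?p j x)\<^sup>2) \<longlonglongrightarrow> K x x"
      using pointwise by (intro AE_I2) (simp add: sums_def)
    show "AE x in \<Lambda>. norm (\<Sum>j<N. (?p j x)\<^sup>2) \<le> K x x" for N
      using power_function_eq(2)[OF \<psi>_orthonormal[OF \<phi>], of "{..<N}"]
      by (intro AE_I2) (simp add: sum_nonneg)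
  qed
  moreover have "(LINT x|\<Lambda>. (\<Sum>j<N. (?p j x)\<^sup>2)) = (\<Sum>j<N. lam j)" for N
  proof -
    have "(LINT x|\<Lambda>. (\<Sum>j<N. (?p j x)\<^sup>2)) = (\<Sum>j<N. l2 (?p j) (?p j))"
      using integrable_H(3)[OF pH] by (simp add: Bochner_Integration.integral_sum l2_def power2_eq_square)
    then show ?thesis using eigenfamily_form_sum(3)[OF \<phi>] by simp
  qed
  ultimately show ?thesis by (simp add: sums_def trace_def)
qed

lemma trace_tail: "trace - (\<Sum>j<n. lam j) = (\<Sum>j. lam (n + j))" "0 \<le> (\<Sum>j. lam (n + j))"
proof -
  have s: "summable lam" using lam_sums_trace by (rule sums_summable)
  show "trace - (\<Sum>j<n. lam j) = (\<Sum>j. lam (n + j))"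
    using suminf_minus_initial_segment[OF s, of n] lam_sums_trace by (simp add: sums_iff add.commute)
  have "summable (\<lambda>j. lam (n + j))" using summable_ignore_initial_segment[OF s, of n] by (simp add: add.commute)
  then show "0 \<le> (\<Sum>j. lam (n + j))" using lam_pos by (intro suminf_nonneg) (auto intro: less_imp_le)
qed

lemma width_lower_bound:
  assumes "V \<in> subspaces_of_dim H n" "n > 0"
  shows "sqrt (\<Sum>j. lam (n + j)) \<le> L2_norm_on \<Omega> (power_function H ip V)"
proof -
  obtain v where v: "orthonormal_on {..<n} v" "span (v ` {..<n}) = V"
    using orthonormal_basis_of_subspace assms by blast
  show ?thesis
    using L2_norm_power_function[OF v(1)] Ky_Fan_le[OF v(1)] v(2) trace_tail(1)[of n] by simp
qed

lemma eigenspan_power_norm: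
  assumes "eigenfamily \<phi>"
  shows "span (\<phi> ` {..<n}) \<in> subspaces_of_dim H n"
    "L2_norm_on \<Omega> (power_function H ip (span (\<phi> ` {..<n}))) = sqrt (\<Sum>j. lam (n + j))"
  using eigenfamily_form_sum[OF assms, of n] span_orthonormal_in_subspaces[of n "\<psi> \<phi>"]
    L2_norm_power_function[of "{..<n}" "\<psi> \<phi>"] trace_tail(1)[of n] by simp_all

lemma power_width_eq:
  assumes "n > 0"
  shows "power_width \<Omega> H ip n = sqrt (\<Sum>j. lam (n + j))"
  unfolding power_width_def
proof (rule cInf_eq_minimum)
  obtain \<phi> where "eigenfamily \<phi>" by (rule eigenfamily_exists)
  then show "sqrt (\<Sum>j. lam (n + j)) \<in> (\<lambda>V. L2_norm_on \<Omega> (power_function H ip V)) ` subspaces_of_dim H n"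
    using eigenspan_power_norm[of \<phi> n] by (metis imageI)
qed (use width_lower_bound assms in auto)

text \<open>
  The power norm of a subspace equals the minimal value exactly when its trace attains the Ky Fan bound.
\<close>

lemma optimal_subspace_iff:
  assumes n: "n > 0"
  shows "optimal_subspace \<Omega> H ip n V \<longleftrightarrow> (\<exists>\<phi>. eigenfamily \<phi> \<and> V = span (\<phi> ` {..<n}))"
proof
  assume "\<exists>\<phi>. eigenfamily \<phi> \<and> V = span (\<phi> ` {..<n})"
  then show "optimal_subspace \<Omega> H ip n V"
    using eigenspan_power_norm power_width_eq[OF n] by (auto simp: optimal_subspace_def)
next
  assume V: "optimal_subspace \<Omega> H ip n V"
  then obtain v where v: "orthonormal_on {..<n} v" "span (v ` {..<n}) = V"
    using orthonormal_basis_of_subspace n unfolding optimal_subspace_def by blast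
  have "sqrt (trace - (\<Sum>i<n. l2 (v i) (v i))) = sqrt (trace - (\<Sum>j<n. lam j))"
    using V L2_norm_power_function[OF v(1)] v(2) power_width_eq[OF n] trace_tail(1)[of n]
    by (simp add: optimal_subspace_def)
  then have "(\<Sum>i<n. l2 (v i) (v i)) = (\<Sum>j<n. lam j)" by simp
  then obtain \<phi> where "eigenfamily \<phi>" "span (v ` {..<n}) = span (\<phi> ` {..<n})"
    using Ky_Fan_equality[OF v(1) n] by blast
  with v show "\<exists>\<phi>. eigenfamily \<phi> \<and> V = span (\<phi> ` {..<n})" by blast
qed

end

theorem theorem9:
  fixes \<Omega> :: "(real ^ 'd) set"
    and K :: "real ^ 'd \<Rightarrow> real ^ 'd \<Rightarrow> real"
    and H :: "(real ^ 'd \<Rightarrow> real) set"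
    and ip :: "(real ^ 'd \<Rightarrow> real) \<Rightarrow> (real ^ 'd \<Rightarrow> real) \<Rightarrow> real"
    and lam :: "nat \<Rightarrow> real"
    and n :: nat
  assumes "\<Omega> \<noteq> {}" and "compact \<Omega>" and "full_support \<Omega>"
    and "continuous_on (\<Omega> \<times> \<Omega>) (\<lambda>(x, y). K x y)"
    and "symmetric_kernel \<Omega> K"
    and "positive_definite_kernel \<Omega> K"
    and "native_space \<Omega> K H ip"
    and "positive_eigenvalues \<Omega> K lam"
    and "n > 0"
  shows "summable lam \<and>
    power_width \<Omega> H ip n = sqrt (\<Sum>j. lam (n + j)) \<and>
    (\<exists>V. optimal_subspace \<Omega> H ip n V) \<and>
    (\<forall>\<phi>. orthonormal_eigenfunctions \<Omega> K H lam \<phi> \<longrightarrow>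
       optimal_subspace \<Omega> H ip n (span ((\<lambda>j. sqrt (lam j) *\<^sub>R \<phi> j) ` {..<n}))) \<and>
    (\<forall>V. optimal_subspace \<Omega> H ip n V \<longleftrightarrow>
       (\<exists>\<phi>. orthonormal_eigenfunctions \<Omega> K H lam \<phi> \<and> V = span (\<phi> ` {..<n})))"
proof -
  interpret native_space_spectrum \<Omega> K H ip lam
    using assms by unfold_locales
  have scaled: "span ((\<lambda>j. sqrt (lam j) *\<^sub>R \<phi> j) ` {..<n}) = span (\<phi> ` {..<n})"
    for \<phi> :: "nat \<Rightarrow> real ^ 'd \<Rightarrow> real"
    using lam_pos by (intro span_scaled_family) (metis less_irrefl real_sqrt_eq_zero_cancel_iff)
  show ?thesis
    unfolding orthonormal_eigenfunctions_iff optimal_subspace_iff[OF \<open>n > 0\<close>] scaled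
    using sums_summable[OF lam_sums_trace] power_width_eq[OF \<open>n > 0\<close>] eigenfamily_exists by blast
qed

end
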